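(* Let $F$ be a form of degree $6$ in $4$ variables over $\mathbb{C}$, with a non-redundant decomposition $A\subset\mathbb{P}^3$ of length $r=15$ which is in General Position. Assume that the base locus of the system of cubic surfaces through $A$ contains no curves. Then $A$ is the unique minimal decomposition of $F$ (i.e. $F$ has Waring rank $15$ and $A$ is the only decomposition of $F$ of length $15$).
   Context: All polynomials are over $\mathbb{C}$. Linear forms in $4$ variables, up to scalar, are regarded as points of a projective space $\mathbb{P}^3$, and forms of degree $6$ in $4$ variables, up to scalar, as points of $\mathbb{P}^{83}$; $v_6:\mathbb{P}^3\to\mathbb{P}^{83}$, $L\mapsto L^6$, is the $6$-Veronese map. The length $\ell(A)$ of a finite set $A$ is its cardinality. A decomposition of $F$ of length $r$ is a finite set $A=\{L_1,\dots,L_r\}\subset\mathbb{P}^3$ such that $F=\sum_{i=1}^r a_iL_i^6$ for some $a_i\in\mathbb{C}$, i.e. $F$ belongs to the linear span $\langle v_6(A)\rangle$. It is non-redundant if the powers $L_1^6,\dots,L_r^6$ are linearly independent and no coefficient $a_i$ is $0$; equivalently, $F\notin\langle v_6(A')\rangle$ for every proper subset $A'\subsetneq A$. The Waring rank of $F$ is the minimal length of a decomposition of $F$; a decomposition is minimal if its length equals the Waring rank. A finite set $A\subset\mathbb{P}^3$ is in General Position if every subset $A'\subseteq A$ has maximal Hilbert function, i.e. $h_{A'}(i)=\min\{\ell(A'),\binom{i+3}{3}\}$ for all $i\ge 0$. *)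

theory Defs
  imports
    "HOL-Analysis.Analysis"
    "HOL-Library.Poly_Mapping"
    "HOL-Library.Numeral_Type"
    "HOL-Library.Extended_Nat"
begin

section \<open>The polynomial ring in four variables\<close>

text \<open>A polynomial is a finitely supported family of complex coefficients indexed by exponent
  vectors \<^typ>\<open>4 \<Rightarrow>\<^sub>0 nat\<close>; the ring structure (convolution) is that of \<^theory>\<open>HOL-Library.Poly_Mapping\<close>.\<close>

type_synonym poly4 = "(4 \<Rightarrow>\<^sub>0 nat) \<Rightarrow>\<^sub>0 complex"

definition pscale :: "complex \<Rightarrow> poly4 \<Rightarrow> poly4" where
  "pscale c p = Poly_Mapping.single 0 c * p"

lemma vector_space_pscale: "vector_space pscale"
proof
  fix a b :: complex and x y :: poly4
  show "pscale a (x + y) = pscale a x + pscale a y"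
    by (simp add: pscale_def distrib_left)
  show "pscale (a + b) x = pscale a x + pscale b x"
    by (simp add: pscale_def single_add distrib_right)
  show "pscale a (pscale b x) = pscale (a * b) x"
    by (simp add: pscale_def mult_single flip: mult.assoc)
  show "pscale 1 x = x"
    by (simp add: pscale_def)
qed

interpretation poly4: vector_space pscale
  by (rule vector_space_pscale)

definition forms :: "nat \<Rightarrow> poly4 set" where
  "forms d = {p. \<forall>m \<in> Poly_Mapping.keys p. (\<Sum>i\<in>UNIV. Poly_Mapping.lookup m i) = d}"

definition eval_poly :: "poly4 \<Rightarrow> complex ^ 4 \<Rightarrow> complex" where
  "eval_poly p v = (\<Sum>m\<in>Poly_Mapping.keys p.
     Poly_Mapping.lookup p m * (\<Prod>i\<in>UNIV. (v $ i) ^ Poly_Mapping.lookup m i))"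

definition linear_form :: "complex ^ 4 \<Rightarrow> poly4" where
  "linear_form v = (\<Sum>i\<in>UNIV. Poly_Mapping.single (Poly_Mapping.single i 1) (v $ i))"


section \<open>Projective space and its Zariski topology\<close>

text \<open>Points are the lines through the origin of \<^typ>\<open>complex ^ 4\<close>. The point spanned by \<open>v\<close> is
  identified with the class of \<open>linear_form v\<close> up to scalar, so the homogeneous coordinates of
  a linear form are its coefficients.\<close>

typedef proj3 = "{vec.span {v} | v :: complex ^ 4. v \<noteq> 0}"
  morphisms line_of Abs_proj3
proof -
  have "(1 :: complex ^ 4) \<noteq> 0" by simp
  then show ?thesis by blast
qed

definition coords :: "proj3 \<Rightarrow> (complex ^ 4) set" where
  "coords P = line_of P - {0}"

text \<open>Only meaningful for forms, whose vanishing is independent of the chosen coordinates.\<close>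

definition vanishes_at :: "poly4 \<Rightarrow> proj3 \<Rightarrow> bool" where
  "vanishes_at p P \<longleftrightarrow> (\<forall>v\<in>coords P. eval_poly p v = 0)"

definition zero_locus :: "poly4 set \<Rightarrow> proj3 set" where
  "zero_locus S = {P. \<forall>p\<in>S. vanishes_at p P}"

definition zariski_closed :: "proj3 set \<Rightarrow> bool" where
  "zariski_closed Z \<longleftrightarrow> (\<exists>S \<subseteq> (\<Union>d. forms d). Z = zero_locus S)"

definition irreducible_closed :: "proj3 set \<Rightarrow> bool" where
  "irreducible_closed Z \<longleftrightarrow> zariski_closed Z \<and> Z \<noteq> {} \<and>
     (\<forall>Z1 Z2. zariski_closed Z1 \<and> zariski_closed Z2 \<and> Z = Z1 \<union> Z2 \<longrightarrow> Z = Z1 \<or> Z = Z2)"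

text \<open>Krull dimension: the supremum of the lengths \<open>n\<close> of strictly increasing chains
  \<open>C 0 \<subset> \<dots> \<subset> C n\<close> of irreducible closed subsets. The empty set gets dimension \<open>0\<close>,
  but the dimension is only used for irreducible (hence nonempty) sets.\<close>

definition zariski_dim :: "proj3 set \<Rightarrow> enat" where
  "zariski_dim Z = Sup {enat n | n. \<exists>C :: nat \<Rightarrow> proj3 set.
     (\<forall>i\<le>n. irreducible_closed (C i) \<and> C i \<subseteq> Z) \<and> (\<forall>i<n. C i \<subset> C (Suc i))}"

text \<open>Every curve contains an irreducible one, so irreducible curves suffice to express that a
  set contains no curves.\<close>

definition irreducible_curve :: "proj3 set \<Rightarrow> bool" where
  "irreducible_curve C \<longleftrightarrow> irreducible_closed C \<and> zariski_dim C = 1"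

definition contains_no_curves :: "proj3 set \<Rightarrow> bool" where
  "contains_no_curves Z \<longleftrightarrow> \<not> (\<exists>C. irreducible_curve C \<and> C \<subseteq> Z)"


section \<open>Hilbert functions and base loci\<close>

definition forms_through :: "proj3 set \<Rightarrow> nat \<Rightarrow> poly4 set" where
  "forms_through A d = {p \<in> forms d. \<forall>P\<in>A. vanishes_at p P}"

text \<open>The dimension of the degree \<open>d\<close> part of the coordinate ring of \<open>A\<close>.\<close>

definition hilbert_function :: "proj3 set \<Rightarrow> nat \<Rightarrow> nat" where
  "hilbert_function A d = poly4.dim (forms d) - poly4.dim (forms_through A d)"

definition general_position :: "proj3 set \<Rightarrow> bool" where
  "general_position A \<longleftrightarrow> finite A \<and>
     (\<forall>A'\<subseteq>A. \<forall>i. hilbert_function A' i = min (card A') ((i + 3) choose 3))"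

definition base_locus :: "proj3 set \<Rightarrow> nat \<Rightarrow> proj3 set" where
  "base_locus A d = zero_locus (forms_through A d)"


section \<open>Waring decompositions\<close>

text \<open>All representatives of the points of the Veronese image of \<open>A\<close>.\<close>

definition veronese :: "nat \<Rightarrow> proj3 set \<Rightarrow> poly4 set" where
  "veronese d A = {linear_form v ^ d | v P. P \<in> A \<and> v \<in> coords P}"

definition decomposition :: "nat \<Rightarrow> poly4 \<Rightarrow> proj3 set \<Rightarrow> bool" where
  "decomposition d F A \<longleftrightarrow> finite A \<and> F \<in> poly4.span (veronese d A)"

definition nonredundant_decomposition :: "nat \<Rightarrow> poly4 \<Rightarrow> proj3 set \<Rightarrow> bool" where
  "nonredundant_decomposition d F A \<longleftrightarrow> decomposition d F A \<and>
     (\<forall>A'. A' \<subset> A \<longrightarrow> F \<notin> poly4.span (veronese d A'))"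

definition waring_rank :: "nat \<Rightarrow> poly4 \<Rightarrow> nat" where
  "waring_rank d F = (LEAST r. \<exists>A. decomposition d F A \<and> card A = r)"

definition minimal_decomposition :: "nat \<Rightarrow> poly4 \<Rightarrow> proj3 set \<Rightarrow> bool" where
  "minimal_decomposition d F A \<longleftrightarrow> decomposition d F A \<and> card A = waring_rank d F"

end

theory Submission
  imports Defs "HOL-Computational_Algebra.Fundamental_Theorem_Algebra"
    "HOL-Computational_Algebra.Polynomial_Factorial" "HOL-Computational_Algebra.Field_as_Ring"
begin

text \<open>Let \<open>B \<noteq> A\<close> be another decomposition with at most 15 points. Comparing the two expressions of
  \<open>F\<close> gives a relation \<open>\<Sum>z\<in>Z. c z * G z = 0\<close>, valid for all sextic forms \<open>G\<close>, with nonzero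
  coefficients on a nonempty set \<open>Z \<subseteq> A \<union> B\<close>, at least half of which lies in \<open>A\<close>. Taking for \<open>G\<close>
  products of two cubics and using that cubics separate the points of \<open>A\<close>, one finds that every
  cubic through \<open>A\<close> vanishes on \<open>Z\<close>.

  The base locus of these cubics is finite, because an infinite closed set contains a curve; so
  some linear form \<open>l\<close> has no zero on it, and the cubics restricted to the plane \<open>l = 0\<close> have no
  common zero. As in Macaulay's theorem on three ternary cubics (socle degree \<open>3 * 3 - 3 = 6\<close>), they
  generate all ternary forms of degree 7. Hence every form of degree at least 7 agrees on \<open>Z\<close> with a
  multiple of a sextic by a power of \<open>l\<close>. As forms of high degree separate points, all
  coefficients of the relation vanish, a contradiction.\<close>

section \<open>Polynomials and forms in four variables\<close>

text \<open>The degree 7 is one above the degree of \<open>F\<close>, and this is what lets a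
  relation between values of sextics spread to all higher degrees. It arises as 5 + 3 - 1: two
  binary cubics without common zero generate all binary forms of degree 5 = 3 + 3 - 1,
  multiplication by one more cubic adds 3, and division by the coordinate \<open>Var 2\<close>, a
  non-zero-divisor modulo the two cubics, subtracts 1. This descent needs a starting degree in which
  the ideal contains everything, which is the Nullstellensatz for the linear system. It is obtained
  by hand: a dimension count gives a form in \<open>Var 3\<close> and \<open>Var 2\<close> in the
  ideal of two cubics, it splits into linear factors over the complex numbers, and the question
  passes from the plane to lines and then to points. Only two cubics are ever fixed; the third is
  any member of the system that is nonzero at the point under consideration.\<close>

abbreviation Cst :: "complex \<Rightarrow> poly4" where
  "Cst c \<equiv> Poly_Mapping.single 0 c"

abbreviation Var :: "4 \<Rightarrow> poly4" where
  "Var i \<equiv> Poly_Mapping.single (Poly_Mapping.single i (Suc 0)) 1"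

definition monom_val :: "(4 \<Rightarrow>\<^sub>0 nat) \<Rightarrow> complex ^ 4 \<Rightarrow> complex" where
  "monom_val m v = (\<Prod>i\<in>UNIV. (v $ i) ^ Poly_Mapping.lookup m i)"

definition mdeg :: "(4 \<Rightarrow>\<^sub>0 nat) \<Rightarrow> nat" where
  "mdeg m = (\<Sum>i\<in>UNIV. Poly_Mapping.lookup m i)"

lemma monom_val_add: "monom_val (a + b) v = monom_val a v * monom_val b v"
  by (simp add: monom_val_def lookup_add power_add prod.distrib)

lemma monom_val_zero [simp]: "monom_val 0 v = 1"
  by (simp add: monom_val_def)

lemma monom_val_single [simp]: "monom_val (Poly_Mapping.single i (Suc 0)) v = v $ i"
proof -
  have "monom_val (Poly_Mapping.single i (Suc 0)) v = (\<Prod>j\<in>UNIV. if j = i then v $ j else 1)"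
    unfolding monom_val_def by (intro prod.cong) (auto simp: lookup_single when_def)
  then show ?thesis by simp
qed

lemma mdeg_add: "mdeg (a + b) = mdeg a + mdeg b"
  by (simp add: mdeg_def lookup_add sum.distrib)

lemma mdeg_zero [simp]: "mdeg 0 = 0"
  by (simp add: mdeg_def)

lemma mdeg_single [simp]: "mdeg (Poly_Mapping.single i (Suc 0)) = 1"
proof -
  have "mdeg (Poly_Mapping.single i (Suc 0)) = (\<Sum>j\<in>UNIV. if j = i then 1 else 0)"
    unfolding mdeg_def by (intro sum.cong) (auto simp: lookup_single when_def)
  then show ?thesis by simp
qed

lemma poly4_sum_monomials:
  "p = (\<Sum>m\<in>Poly_Mapping.keys p. Poly_Mapping.single m (Poly_Mapping.lookup p m))"
proof (rule poly_mapping_eqI)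
  fix k
  have "(\<Sum>m\<in>Poly_Mapping.keys p. Poly_Mapping.lookup (Poly_Mapping.single m (Poly_Mapping.lookup p m)) k)
    = (\<Sum>m\<in>Poly_Mapping.keys p. if m = k then Poly_Mapping.lookup p k else 0)"
    by (intro sum.cong) (auto simp: lookup_single when_def)
  then show "Poly_Mapping.lookup p k = Poly_Mapping.lookup
      (\<Sum>m\<in>Poly_Mapping.keys p. Poly_Mapping.single m (Poly_Mapping.lookup p m)) k"
    by (simp add: lookup_sum in_keys_iff)
qed

section \<open>Evaluation as a ring homomorphism\<close>

lemma eval_poly_superset:
  assumes "finite K" "Poly_Mapping.keys p \<subseteq> K"
  shows "eval_poly p v = (\<Sum>m\<in>K. Poly_Mapping.lookup p m * monom_val m v)"
  unfolding eval_poly_def monom_val_def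
  by (intro sum.mono_neutral_left) (use assms in \<open>auto simp: in_keys_iff\<close>)

lemma eval_poly_add [simp]: "eval_poly (p + q) v = eval_poly p v + eval_poly q v"
proof -
  let ?K = "Poly_Mapping.keys p \<union> Poly_Mapping.keys q"
  have "Poly_Mapping.keys (p + q) \<subseteq> ?K" by (rule keys_add)
  then show ?thesis
    by (simp add: eval_poly_superset[of ?K] lookup_add distrib_right sum.distrib)
qed

lemma eval_poly_zero [simp]: "eval_poly 0 v = 0"
  by (simp add: eval_poly_def)

lemma eval_poly_sum [simp]: "eval_poly (sum f K) v = (\<Sum>k\<in>K. eval_poly (f k) v)"
  by (induction K rule: infinite_finite_induct) auto

lemma eval_poly_monomial: "eval_poly (Poly_Mapping.single m c) v = c * monom_val m v"
  by (subst eval_poly_superset[of "{m}"]) auto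

lemma eval_poly_mult [simp]: "eval_poly (p * q) v = eval_poly p v * eval_poly q v"
proof -
  let ?s = "\<lambda>p m. Poly_Mapping.single m (Poly_Mapping.lookup p m) :: poly4"
  have "p * q = (\<Sum>a\<in>Poly_Mapping.keys p. \<Sum>b\<in>Poly_Mapping.keys q. ?s p a * ?s q b)"
    by (subst poly4_sum_monomials[of p], subst poly4_sum_monomials[of q]) (rule sum_product)
  moreover have "eval_poly p v * eval_poly q v
      = (\<Sum>a\<in>Poly_Mapping.keys p. \<Sum>b\<in>Poly_Mapping.keys q. eval_poly (?s p a) v * eval_poly (?s q b) v)"
    by (subst poly4_sum_monomials[of p], subst poly4_sum_monomials[of q])
      (simp add: sum_product)
  ultimately show ?thesis
    by (simp add: mult_single eval_poly_monomial monom_val_add mult_ac)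
qed

lemma eval_poly_Cst [simp]: "eval_poly (Cst c) v = c"
  by (simp add: eval_poly_monomial)

lemma eval_poly_one [simp]: "eval_poly 1 v = 1"
  using eval_poly_Cst[of 1 v] by simp

lemma eval_poly_Var [simp]: "eval_poly (Var i) v = v $ i"
  using monom_val_single[of i v] by (simp add: eval_poly_monomial)

lemma eval_poly_uminus [simp]: "eval_poly (- p) v = - eval_poly p v"
  using eval_poly_add[of p "- p" v] by (simp add: add_eq_0_iff)

lemma eval_poly_diff [simp]: "eval_poly (p - q) v = eval_poly p v - eval_poly q v"
  using eval_poly_add[of p "- q" v] by simp

lemma eval_poly_power [simp]: "eval_poly (p ^ n) v = eval_poly p v ^ n"
  by (induction n) auto

lemma pscale_eq: "pscale c p = Cst c * p"
  by (simp add: pscale_def)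

text \<open>The forms of degree \<open>d\<close> in a given set \<open>L\<close> of linear forms. Describing forms by arbitrary
  generators makes it possible to change coordinates without transforming polynomials.\<close>

inductive hform :: "poly4 set \<Rightarrow> nat \<Rightarrow> poly4 \<Rightarrow> bool" for L where
  zero: "hform L d 0"
| const: "hform L 0 (Cst c)"
| add: "hform L d p \<Longrightarrow> hform L d q \<Longrightarrow> hform L d (p + q)"
| gen: "x \<in> L \<Longrightarrow> hform L d p \<Longrightarrow> hform L (Suc d) (x * p)"

definition hf :: "poly4 set \<Rightarrow> nat \<Rightarrow> poly4 set" where
  "hf L d = {p. hform L d p}"

lemma hform_hf_eq: "hform L d p = (p \<in> hf L d)"
  by (simp add: hf_def)

lemmas hf_intros = hform.intros[unfolded hform_hf_eq]
lemmas hf_zero = hform.zero[unfolded hform_hf_eq]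
lemmas hf_const = hform.const[unfolded hform_hf_eq]
lemmas hf_add = hform.add[unfolded hform_hf_eq]
lemmas hf_gen = hform.gen[unfolded hform_hf_eq]
lemmas hf_induct [consumes 1, case_names zero const add gen] = hform.induct[unfolded hform_hf_eq]

lemma hf_Cst_mult: "p \<in> hf L d \<Longrightarrow> Cst c * p \<in> hf L d"
proof (induction rule: hf_induct)
  case (const c') then show ?case by (simp add: mult_single hf_const)
next
  case (gen x d p) then show ?case using hf_gen[of x L "Cst c * p" d] by (simp add: mult.left_commute)
qed (auto simp: distrib_left intro: hf_intros)

lemma hf_uminus: "p \<in> hf L d \<Longrightarrow> - p \<in> hf L d"
  using hf_Cst_mult[of p L d "-1"] by (simp only: single_uminus single_one mult_minus1)

lemma hf_diff: "p \<in> hf L d \<Longrightarrow> q \<in> hf L d \<Longrightarrow> p - q \<in> hf L d"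
  using hf_add[of p L d "- q"] hf_uminus[of q L d] by simp

lemma hf_sum: "(\<And>k. k \<in> K \<Longrightarrow> f k \<in> hf L d) \<Longrightarrow> sum f K \<in> hf L d"
  by (induction K rule: infinite_finite_induct) (auto intro: hf_intros)

lemma hf_mult: "p \<in> hf L d \<Longrightarrow> q \<in> hf L e \<Longrightarrow> p * q \<in> hf L (d + e)"
  by (induction rule: hf_induct) (auto simp: distrib_right mult.assoc hf_Cst_mult intro: hf_intros)

lemma hf_one: "1 \<in> hf L 0"
  using hf_const[of 1 L] by simp

lemma hf_generator: "x \<in> L \<Longrightarrow> x \<in> hf L (Suc 0)"
  using hf_gen[of x L 1 0] by (simp add: hf_one)

lemma hf_power: "p \<in> hf L d \<Longrightarrow> p ^ n \<in> hf L (n * d)"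
  by (induction n) (auto simp: hf_one hf_mult)

lemma hf_generators:
  assumes "L \<subseteq> hf L' (Suc 0)" and "p \<in> hf L d"
  shows "p \<in> hf L' d"
  using assms(2)
proof (induction rule: hf_induct)
  case (gen x d p)
  then show ?case using hf_mult[of x L' "Suc 0" p d] assms(1) by auto
qed (auto intro: hf_intros)

lemma hf_mono: "L \<subseteq> L' \<Longrightarrow> p \<in> hf L d \<Longrightarrow> p \<in> hf L' d"
  by (rule hf_generators[of L]) (auto intro: hf_generator)

text \<open>Division by the generator \<open>m\<close>, with \<open>p0\<close> in the role of the
  restriction of \<open>p\<close> to \<open>m = 0\<close>. Truncated subtraction gives
  \<open>p1\<close> degree 0 also for \<open>d = 0\<close>; the last clause forces
  \<open>p1 = 0\<close> there, for otherwise \<open>x * p1\<close> in the case \<open>gen\<close>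
  would have degree 1 instead of 0.\<close>

lemma hf_insert_split_aux:
  "p \<in> hf (insert m L) d \<Longrightarrow>
    \<exists>p0\<in>hf L d. \<exists>p1\<in>hf (insert m L) (d - 1). p = p0 + m * p1 \<and> (d = 0 \<longrightarrow> p1 = 0)"
proof (induction rule: hf_induct)
  case (zero d)
  then show ?case by (intro bexI[of _ 0]) (auto intro: hf_intros)
next
  case (const c)
  then show ?case by (intro bexI[of _ "Cst c"] bexI[of _ 0]) (auto intro: hf_intros)
next
  case (add d p q)
  then obtain p0 p1 q0 q1 where "p0 \<in> hf L d" "p1 \<in> hf (insert m L) (d - 1)" "p = p0 + m * p1"
    "q0 \<in> hf L d" "q1 \<in> hf (insert m L) (d - 1)" "q = q0 + m * q1" "d = 0 \<longrightarrow> p1 = 0" "d = 0 \<longrightarrow> q1 = 0"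
    by blast
  then show ?case
    by (intro bexI[of _ "p0 + q0"] bexI[of _ "p1 + q1"]) (auto simp: algebra_simps intro: hf_intros)
next
  case (gen x d p)
  then obtain p0 p1 where p: "p0 \<in> hf L d" "p1 \<in> hf (insert m L) (d - 1)" "p = p0 + m * p1"
      "d = 0 \<longrightarrow> p1 = 0"
    by blast
  show ?case
  proof (cases "x = m")
    case True
    then show ?thesis using gen by (intro bexI[of _ 0] bexI[of _ p]) (auto intro: hf_intros)
  next
    case False
    have "x * p1 \<in> hf (insert m L) d"
      using p gen.hyps(1) hf_gen[of x "insert m L" p1 "d - 1"] by (cases d) (auto intro: hf_zero)
    moreover have "x * p0 \<in> hf L (Suc d)" using p gen.hyps False by (intro hf_gen) auto
    moreover have "x * p = x * p0 + m * (x * p1)" using p by (simp add: algebra_simps)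
    ultimately show ?thesis by auto
  qed
qed

lemma hf_insert_split:
  assumes "p \<in> hf (insert m L) (Suc d)"
  obtains p0 p1 where "p0 \<in> hf L (Suc d)" "p1 \<in> hf (insert m L) d" "p = p0 + m * p1"
  using hf_insert_split_aux[OF assms] that by auto

text \<open>Finiteness alone is wanted: it forces the linear dependence behind
  \<open>binary_eliminant\<close>.\<close>

lemma hf_finite_span:
  assumes "finite L"
  shows "\<exists>E. finite E \<and> hf L d \<subseteq> poly4.span E"
proof -
  \<comment> \<open>\<open>E d\<close> collects all products of \<open>d\<close> elements of
    \<open>L\<close>.\<close>
  define E where "E = rec_nat {1::poly4} (\<lambda>_ E. (\<lambda>(x, e). x * e) ` (L \<times> E))"
  have fin: "finite (E d)" for d by (induction d) (auto simp: E_def assms)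
  have mul: "x * p \<in> poly4.span (E (Suc d))" if "p \<in> poly4.span (E d)" "x \<in> L" for x p d
    using that(1)
  proof (induction rule: poly4.span_induct_alt)
    case base then show ?case by (simp add: poly4.span_zero)
  next
    case (step c e q)
    have "x * e \<in> E (Suc d)" using step that(2) by (auto simp: E_def)
    then have "pscale c (x * e) + x * q \<in> poly4.span (E (Suc d))"
      using step by (blast intro: poly4.span_add poly4.span_scale poly4.span_base)
    moreover have "pscale c (x * e) + x * q = x * (pscale c e + q)"
      by (simp add: pscale_eq algebra_simps)
    ultimately show ?case by simp
  qed
  have "p \<in> hf L d \<Longrightarrow> p \<in> poly4.span (E d)" for p
  proof (induction rule: hf_induct)
    case (const c)
    have "pscale c 1 \<in> poly4.span (E 0)" by (intro poly4.span_scale poly4.span_base) (simp add: E_def)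
    moreover have "pscale c 1 = Cst c" by (simp add: pscale_eq)
    ultimately show ?case by simp
  qed (auto intro: poly4.span_zero poly4.span_add mul)
  then show ?thesis using fin by blast
qed

section \<open>Forms in the four coordinates\<close>

lemma Var_hf: "Var i \<in> hf (range Var) (Suc 0)"
  by (rule hf_generator) blast

lemma monomial_hf: "mdeg m = d \<Longrightarrow> Poly_Mapping.single m c \<in> hf (range Var) d"
proof (induction d arbitrary: m)
  case 0
  then have "m = 0" by (intro poly_mapping_eqI) (auto simp: mdeg_def)
  then show ?case by (simp add: hf_const)
next
  case (Suc d)
  then obtain i where i: "Poly_Mapping.lookup m i \<noteq> 0" by (metis mdeg_def nat.distinct(1) sum.neutral)
  define m' where "m' = m - Poly_Mapping.single i (Suc 0)"
  have m: "m = Poly_Mapping.single i (Suc 0) + m'"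
    using i by (intro poly_mapping_eqI) (auto simp: m'_def lookup_add lookup_minus lookup_single when_def)
  have "mdeg m' = d" using Suc.prems by (subst (asm) m) (simp add: mdeg_add)
  then have "Var i * Poly_Mapping.single m' c \<in> hf (range Var) (Suc d)"
    using Suc.IH by (intro hf_gen) auto
  then show ?case by (subst m) (simp add: mult_single)
qed

lemma forms_mdeg: "p \<in> forms d \<longleftrightarrow> (\<forall>m\<in>Poly_Mapping.keys p. mdeg m = d)"
  by (simp add: forms_def mdeg_def)

lemma forms_eq_hf: "forms d = hf (range Var) d"
proof (intro equalityI subsetI)
  fix p assume "p \<in> forms d"
  then show "p \<in> hf (range Var) d"
    by (subst poly4_sum_monomials, intro hf_sum monomial_hf) (simp add: forms_mdeg)
next
  fix p assume "p \<in> hf (range Var) d"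
  then show "p \<in> forms d"
  proof (induction rule: hf_induct)
    case (add d p q)
    then show ?case using keys_add[of p q] by (auto simp: forms_mdeg)
  next
    case (gen x d p)
    then obtain i where "x = Var i" by blast
    have "mdeg m = Suc d" if m: "m \<in> Poly_Mapping.keys (x * p)" for m
    proof -
      obtain a b where "a \<in> Poly_Mapping.keys x" "b \<in> Poly_Mapping.keys p" "m = a + b"
        using keys_mult[of x p] m by blast
      then show ?thesis using gen \<open>x = Var i\<close> by (simp add: forms_mdeg mdeg_add)
    qed
    then show ?case by (simp add: forms_mdeg)
  qed (auto simp: forms_mdeg)
qed

lemma forms_one_range: "forms (Suc 0) = range linear_form"
proof (intro equalityI subsetI)
  fix p assume p: "p \<in> forms (Suc 0)"
  have "p \<in> range linear_form" if "p \<in> hf (range Var) d" "d = Suc 0" for p d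
    using that
  proof (induction rule: hf_induct)
    case (zero d)
    have "linear_form 0 = 0" by (simp add: linear_form_def)
    then show ?case by (metis rangeI)
  next
    case (add d p q)
    then obtain v w where "p = linear_form v" "q = linear_form w" by blast
    then have "p + q = linear_form (v + w)" by (simp add: linear_form_def single_add sum.distrib)
    then show ?case by blast
  next
    case (gen x d p)
    have "\<exists>c. q = Cst c" if "q \<in> hf (range Var) e" "e = 0" for q e
      using that
    proof (induction rule: hf_induct)
      case (zero d) then show ?case by (metis single_zero)
    next
      case (add d p q) then show ?case by (metis single_add)
    qed auto
    then obtain c i where "p = Cst c" "x = Var i" using gen by blast
    then have "x * p = Poly_Mapping.single (Poly_Mapping.single i 1) c"
      by (simp add: mult_single)
    also have "\<dots> = linear_form (\<chi> j. if j = i then c else 0)"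
      by (simp add: linear_form_def if_distrib sum.delta cong: if_cong)
    finally show ?case by blast
  qed auto
  then show "p \<in> range linear_form" using p by (simp add: forms_eq_hf)
qed (auto simp: linear_form_def forms_eq_hf intro!: hf_sum monomial_hf)

lemma eval_linear_form: "eval_poly (linear_form v) w = (\<Sum>i\<in>UNIV. v $ i * w $ i)"
  by (simp add: linear_form_def eval_poly_monomial)

lemma linear_form_eq: "linear_form v = (\<Sum>i\<in>UNIV. Cst (v $ i) * Var i)"
  by (simp add: linear_form_def mult_single)

lemma linear_form_scale: "linear_form (c *s v) = Cst c * linear_form v"
  by (simp add: linear_form_def sum_distrib_left mult_single)

lemma forms_mult: "p \<in> forms d \<Longrightarrow> q \<in> forms e \<Longrightarrow> p * q \<in> forms (d + e)"
  by (simp add: forms_eq_hf hf_mult)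

lemma forms_add: "p \<in> forms d \<Longrightarrow> q \<in> forms d \<Longrightarrow> p + q \<in> forms d"
  by (simp add: forms_eq_hf hf_add)

lemma forms_Cst_mult: "p \<in> forms d \<Longrightarrow> Cst c * p \<in> forms d"
  by (simp add: forms_eq_hf hf_Cst_mult)

lemma eval_form_scale:
  assumes "p \<in> forms d"
  shows "eval_poly p (k *s v) = k ^ d * eval_poly p v"
  using assms[unfolded forms_eq_hf]
  by (induction rule: hf_induct) (auto simp: algebra_simps)

text \<open>The constants \<open>k m\<close> are the multinomial coefficients.\<close>

lemma lookup_linear_form_power:
  "\<exists>k :: (4 \<Rightarrow>\<^sub>0 nat) \<Rightarrow> nat. (\<forall>m. mdeg m = d \<longrightarrow> k m > 0) \<and>
     (\<forall>v m. mdeg m = d \<longrightarrow> Poly_Mapping.lookup (linear_form v ^ d) m = of_nat (k m) * monom_val m v)"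
proof (induction d)
  case 0
  have "m = 0" if "mdeg m = 0" for m using that by (intro poly_mapping_eqI) (auto simp: mdeg_def)
  then have "monom_val m v = 1" if "mdeg m = 0" for m v
    using that by (metis monom_val_zero)
  then show ?case using \<open>\<And>m. mdeg m = 0 \<Longrightarrow> m = 0\<close>
    by (intro exI[of _ "\<lambda>_. 1"]) (auto simp: lookup_one)
next
  case (Suc d)
  then obtain k where k: "\<And>m. mdeg m = d \<Longrightarrow> k m > 0"
    "\<And>v m. mdeg m = d \<Longrightarrow> Poly_Mapping.lookup (linear_form v ^ d) m = of_nat (k m) * monom_val m v"
    by blast
  let ?e = "\<lambda>i::4. Poly_Mapping.single i (Suc 0)"
  \<comment> \<open>Pascal-type recursion for multinomial coefficients; the guard excludes indices
    where subtracting exponents would be truncated.\<close>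
  define k' where "k' m = (\<Sum>i\<in>UNIV. if Poly_Mapping.lookup m i > 0 then k (m - ?e i) else 0)" for m
  have split: "m = ?e i + (m - ?e i)" if "Poly_Mapping.lookup m i > 0" for m i
    using that by (intro poly_mapping_eqI) (auto simp: lookup_add lookup_minus lookup_single when_def)
  have deg: "mdeg (m - ?e i) = d" if "Poly_Mapping.lookup m i > 0" "mdeg m = Suc d" for m i
    using that split[of m i] mdeg_add[of "?e i" "m - ?e i"] by simp
  have shift: "Poly_Mapping.lookup (Poly_Mapping.single (?e i) c * q) m =
      (if Poly_Mapping.lookup m i > 0 then c * Poly_Mapping.lookup q (m - ?e i) else 0)"
    for i c m and q :: poly4
  proof -
    have "Poly_Mapping.lookup (Poly_Mapping.single (?e i) c * q) m =
      (\<Sum>b\<in>Poly_Mapping.keys q. Poly_Mapping.lookup (Poly_Mapping.single (?e i + b) (c * Poly_Mapping.lookup q b)) m)"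
      by (subst poly4_sum_monomials[of q]) (simp add: sum_distrib_left mult_single lookup_sum)
    also have "\<dots> = (\<Sum>b\<in>Poly_Mapping.keys q. if Poly_Mapping.lookup m i > 0 \<and> b = m - ?e i then c * Poly_Mapping.lookup q (m - ?e i) else 0)"
    proof (intro sum.cong refl)
      fix b
      have "?e i + b = m \<longleftrightarrow> Poly_Mapping.lookup m i > 0 \<and> b = m - ?e i"
        using split[of m i] by (auto simp: lookup_add)
      then show "Poly_Mapping.lookup (Poly_Mapping.single (?e i + b) (c * Poly_Mapping.lookup q b)) m
        = (if Poly_Mapping.lookup m i > 0 \<and> b = m - ?e i then c * Poly_Mapping.lookup q (m - ?e i) else 0)"
        by (auto simp: lookup_single when_def)
    qed
    also have "\<dots> = (if Poly_Mapping.lookup m i > 0 then c * Poly_Mapping.lookup q (m - ?e i) else 0)"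
      by (cases "Poly_Mapping.lookup m i > 0") (auto simp: in_keys_iff)
    finally show ?thesis .
  qed
  have "Poly_Mapping.lookup (linear_form v ^ Suc d) m = of_nat (k' m) * monom_val m v"
    if m: "mdeg m = Suc d" for v m
  proof -
    have mul: "linear_form v * q = (\<Sum>i\<in>UNIV. Poly_Mapping.single (?e i) (v $ i) * q)" for q
      by (simp add: linear_form_def sum_distrib_right)
    have "Poly_Mapping.lookup (linear_form v ^ Suc d) m =
       (\<Sum>i\<in>UNIV. if Poly_Mapping.lookup m i > 0 then v $ i * Poly_Mapping.lookup (linear_form v ^ d) (m - ?e i) else 0)"
      by (simp only: power_Suc mul lookup_sum shift)
    also have "\<dots> = (\<Sum>i\<in>UNIV. of_nat (if Poly_Mapping.lookup m i > 0 then k (m - ?e i) else 0) * monom_val m v)"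
    proof (intro sum.cong refl)
      fix i
      show "(if Poly_Mapping.lookup m i > 0 then v $ i * Poly_Mapping.lookup (linear_form v ^ d) (m - ?e i) else 0)
        = of_nat (if Poly_Mapping.lookup m i > 0 then k (m - ?e i) else 0) * monom_val m v"
        using k(2)[OF deg[of m i], of v] m monom_val_add[of "?e i" "m - ?e i" v] split[of m i] by auto
    qed
    finally show ?thesis by (simp add: k'_def sum_distrib_right)
  qed
  moreover have "k' m > 0" if m: "mdeg m = Suc d" for m
  proof -
    obtain i where i: "Poly_Mapping.lookup m i > 0" using m by (metis mdeg_def nat.distinct(1) sum.neutral gr0I)
    have "k (m - ?e i) > 0" using i m k(1) deg by blast
    also have "k (m - ?e i) = (if Poly_Mapping.lookup m i > 0 then k (m - ?e i) else 0)" using i by simp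
    also have "\<dots> \<le> k' m" unfolding k'_def by (rule member_le_sum) auto
    finally show ?thesis .
  qed
  ultimately show ?case by blast
qed

text \<open>The coefficient of the power sum at a monomial \<open>m\<close> of degree
  \<open>d\<close> is a positive integer times
  \<open>\<Sum>z\<in>K. c z * monom_val m (r z)\<close>. In characteristic 0 the integer cancels,
  and \<open>G\<close> is a combination of such monomials.\<close>

lemma apolarity:
  assumes "finite K" and "(\<Sum>z\<in>K. Cst (c z) * linear_form (r z) ^ d) = 0" and "G \<in> forms d"
  shows "(\<Sum>z\<in>K. c z * eval_poly G (r z)) = 0"
proof -
  obtain k where k: "\<And>m. mdeg m = d \<Longrightarrow> k m > 0"
    "\<And>v m. mdeg m = d \<Longrightarrow> Poly_Mapping.lookup (linear_form v ^ d) m = of_nat (k m) * monom_val m v"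
    using lookup_linear_form_power[of d] by blast
  have "(\<Sum>z\<in>K. c z * monom_val m (r z)) = 0" if m: "mdeg m = d" for m
  proof -
    have lk: "Poly_Mapping.lookup (Cst c * p) m = c * Poly_Mapping.lookup p m" for c and p :: poly4
      by (simp add: Poly_Mapping.map.rep_eq when_def flip: mult_map_scale_conv_mult)
    have "0 = Poly_Mapping.lookup (\<Sum>z\<in>K. Cst (c z) * linear_form (r z) ^ d) m"
      by (simp add: assms(2))
    also have "\<dots> = of_nat (k m) * (\<Sum>z\<in>K. c z * monom_val m (r z))"
      by (simp add: lookup_sum lk k(2)[OF m] sum_distrib_left mult_ac)
    finally show ?thesis using k(1)[OF m] by simp
  qed
  then have "(\<Sum>m\<in>Poly_Mapping.keys G. Poly_Mapping.lookup G m * (\<Sum>z\<in>K. c z * monom_val m (r z))) = 0"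
    using assms(3) by (intro sum.neutral) (auto simp: forms_mdeg)
  then show ?thesis
    by (simp add: eval_poly_superset[of "Poly_Mapping.keys G" G] sum_distrib_left mult_ac sum.swap[of _ K])
qed

section \<open>Underdetermined linear systems\<close>

text \<open>Gaussian elimination by induction on the equations \<open>E\<close>; \<open>K\<close>
  indexes the unknowns.\<close>

lemma underdetermined_system:
  fixes M :: "'a \<Rightarrow> 'b \<Rightarrow> complex"
  assumes "finite E" "finite K" "card E < card K"
  shows "\<exists>x. (\<exists>i\<in>K. x i \<noteq> 0) \<and> (\<forall>e\<in>E. (\<Sum>i\<in>K. x i * M i e) = 0)"
  using assms
proof (induction E arbitrary: K M rule: finite_induct)
  case empty
  then obtain i where "i \<in> K" by fastforce
  then show ?case by (intro exI[of _ "\<lambda>_. 1"]) auto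
next
  case (insert e E)
  show ?case
  proof (cases "\<forall>i\<in>K. M i e = 0")
    case True
    have "card E < card K" using insert by simp
    with insert.IH[of K M] insert.prems obtain x where
      "\<exists>i\<in>K. x i \<noteq> 0" "\<forall>e\<in>E. (\<Sum>i\<in>K. x i * M i e) = 0" by blast
    then show ?thesis using True by (intro exI[of _ x]) auto
  next
    case False
    then obtain j where j: "j \<in> K" "M j e \<noteq> 0" by blast
    define K' where "K' = K - {j}"
    have K': "finite K'" "card E < card K'" "K = insert j K'" "j \<notin> K'"
      using insert j by (auto simp: K'_def)
    \<comment> \<open>The unknown at \<open>j\<close> is eliminated with pivot \<open>M j e\<close>;
      \<open>x'\<close> restores it from equation \<open>e\<close>.\<close>
    obtain x where x: "\<exists>i\<in>K'. x i \<noteq> 0"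
      "\<forall>e'\<in>E. (\<Sum>i\<in>K'. x i * (M i e' - M i e / M j e * M j e')) = 0"
      using insert.IH[OF K'(1,2), of "\<lambda>i e'. M i e' - M i e / M j e * M j e'"] by blast
    define x' where "x' = x(j := - (\<Sum>i\<in>K'. x i * M i e) / M j e)"
    have x': "(\<Sum>i\<in>K'. x' i * M i e') = (\<Sum>i\<in>K'. x i * M i e')" for e'
      by (intro sum.cong) (use K' in \<open>auto simp: x'_def\<close>)
    have "(\<Sum>i\<in>K. x' i * M i e') = 0" if "e' \<in> insert e E" for e'
    proof (cases "e' = e")
      case True
      then show ?thesis using K' j by (simp add: x') (simp add: x'_def)
    next
      case False
      then have "(\<Sum>i\<in>K'. x i * (M i e' - M i e / M j e * M j e')) = 0" using x that by blast
      moreover have "(\<Sum>i\<in>K'. x i * (M i e' - M i e / M j e * M j e')) =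
        (\<Sum>i\<in>K'. x i * M i e') - (\<Sum>i\<in>K'. x i * M i e) / M j e * M j e'"
        by (simp add: algebra_simps sum_subtractf sum_distrib_left sum_divide_distrib)
      ultimately show ?thesis using K' by (simp add: x') (simp add: x'_def)
    qed
    moreover have "\<exists>i\<in>K. x' i \<noteq> 0" using x K' by (auto simp: x'_def)
    ultimately show ?thesis by blast
  qed
qed

section \<open>Binary forms and univariate polynomials\<close>

text \<open>Homogenisation in \<open>x\<close> and \<open>y\<close>, through which factorisation,
  division with remainder and Bezout identities of univariate polynomials reach binary forms. If
  \<open>degree q < d\<close>, the surplus appears as factors \<open>y\<close>, that is, as zeros at
  infinity.\<close>

definition homog :: "poly4 \<Rightarrow> poly4 \<Rightarrow> nat \<Rightarrow> complex poly \<Rightarrow> poly4" where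
  "homog x y d q = (\<Sum>i\<le>d. Cst (poly.coeff q i) * x ^ i * y ^ (d - i))"

lemma homog_in: "homog x y d q \<in> hf {x, y} d"
proof -
  have "Cst c * x ^ i * y ^ (d - i) \<in> hf {x, y} d" if "i \<le> d" for c i
  proof -
    have "x ^ i * y ^ (d - i) \<in> hf {x, y} (i * Suc 0 + (d - i) * Suc 0)"
      by (intro hf_mult hf_power hf_generator) auto
    then show ?thesis using that by (simp add: hf_Cst_mult mult.assoc)
  qed
  then show ?thesis unfolding homog_def by (intro hf_sum) auto
qed

lemma homog_zero [simp]: "homog x y d 0 = 0"
  by (simp add: homog_def)

lemma homog_add: "homog x y d (p + q) = homog x y d p + homog x y d q"
  by (simp add: homog_def single_add distrib_right sum.distrib)

lemma homog_smult: "homog x y d (smult c q) = Cst c * homog x y d q"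
  by (simp add: homog_def sum_distrib_left mult_single flip: mult.assoc)

lemma homog_uminus: "homog x y d (- q) = - homog x y d q"
  using homog_add[of x y d "- q" q] by (simp add: eq_neg_iff_add_eq_0)

lemma homog_pCons: "homog x y (Suc d) (pCons a p) = Cst a * y ^ Suc d + x * homog x y d p"
  unfolding homog_def by (subst sum.atMost_Suc_shift) (simp add: sum_distrib_left mult_ac)

lemma homog_0: "homog x y 0 q = Cst (poly.coeff q 0)"
  by (simp add: homog_def)

lemma homog_power_mult:
  assumes "degree q \<le> d"
  shows "y ^ k * homog x y d q = homog x y (k + d) q"
proof -
  have "homog x y (k + d) q = (\<Sum>i\<le>d. Cst (poly.coeff q i) * x ^ i * y ^ (k + d - i))"
    unfolding homog_def by (rule sum.mono_neutral_right) (use assms in \<open>auto simp: coeff_eq_0\<close>)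
  also have "\<dots> = y ^ k * homog x y d q"
    unfolding homog_def sum_distrib_left
    by (intro sum.cong) (auto simp: power_add mult_ac simp flip: Nat.add_diff_assoc)
  finally show ?thesis by simp
qed

lemma homog_mult:
  assumes "degree p \<le> d" "degree q \<le> e"
  shows "homog x y d p * homog x y e q = homog x y (d + e) (p * q)"
  using assms(1)
proof (induction d arbitrary: p)
  case 0
  then obtain a where "p = [:a:]" using degree_eq_zeroE by (metis le_zero_eq)
  then show ?case by (simp add: homog_0 homog_smult)
next
  case (Suc d)
  obtain a p' where p: "p = pCons a p'" by (cases p)
  then have "degree p' \<le> d" using Suc.prems by (auto split: if_splits)
  then have "homog x y (Suc d) p * homog x y e q =
      Cst a * (y ^ Suc d * homog x y e q) + x * homog x y (d + e) (p' * q)"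
    using Suc.IH[of p'] by (simp add: p homog_pCons distrib_right mult.assoc)
  also have "\<dots> = homog x y (Suc d + e) (smult a q) + homog x y (Suc (d + e)) (pCons 0 (p' * q))"
    unfolding homog_power_mult[OF assms(2)] by (simp add: homog_smult homog_pCons)
  finally show ?case by (simp add: p homog_add)
qed

lemma homog_exists:
  "p \<in> hf {x, y} d \<Longrightarrow> \<exists>q. degree q \<le> d \<and> p = homog x y d q"
proof (induction rule: hf_induct)
  case (zero d) then show ?case by (intro exI[of _ 0]) auto
next
  case (const c) then show ?case by (intro exI[of _ "[:c:]"]) (auto simp: homog_0)
next
  case (add d p q)
  then show ?case by (metis homog_add degree_add_le)
next
  case (gen z d p)
  then obtain q where q: "degree q \<le> d" "p = homog x y d q" by blast
  show ?case
  proof (cases "z = x")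
    case True
    then show ?thesis using q by (intro exI[of _ "pCons 0 q"]) (auto simp: homog_pCons degree_pCons_le intro: le_trans[OF degree_pCons_le])
  next
    case False
    then have "z = y" using gen by simp
    then show ?thesis using q homog_power_mult[of q d y 1 x] by (intro exI[of _ q]) auto
  qed
qed

lemma eval_homog:
  assumes "degree q \<le> d" "eval_poly y v = 1"
  shows "eval_poly (homog x y d q) v = poly q (eval_poly x v)"
proof -
  have "poly q s = (\<Sum>i\<le>d. poly.coeff q i * s ^ i)" for s
    unfolding poly_altdef by (rule sum.mono_neutral_left) (use assms in \<open>auto simp: coeff_eq_0\<close>)
  then show ?thesis by (simp add: homog_def assms(2))
qed

lemma eval_homog_infinity:
  assumes "eval_poly y v = 0"
  shows "eval_poly (homog x y d q) v = poly.coeff q d * eval_poly x v ^ d"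
proof -
  have "eval_poly (homog x y d q) v = (\<Sum>i\<le>d. if i = d then poly.coeff q d * eval_poly x v ^ d else 0)"
    unfolding homog_def eval_poly_sum by (intro sum.cong) (auto simp: assms)
  then show ?thesis by simp
qed

lemma homog_factors:
  "degree (\<Prod>a\<in>#A. [:- a, 1 :: complex:]) \<le> size A \<and>
    homog x y (size A) (\<Prod>a\<in>#A. [:- a, 1:]) = (\<Prod>a\<in>#A. x - Cst a * y)"
proof (induction A)
  case empty
  then show ?case by (simp add: homog_0)
next
  case (add a A)
  have "homog x y 1 [:- a, 1:] = x - Cst a * y"
    by (simp add: homog_pCons homog_0 single_uminus)
  moreover have "degree ([:- a, 1:] * (\<Prod>a\<in>#A. [:- a, 1:])) \<le> Suc (size A)"
    using add degree_mult_le[of "[:- a, 1:]" "\<Prod>a\<in>#A. [:- a, 1:]"] by simp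
  ultimately show ?case
    using add homog_mult[of "[:- a, 1:]" 1 "\<Prod>a\<in>#A. [:- a, 1:]" "size A" x y] by simp
qed

text \<open>Fundamental theorem of algebra for binary forms: \<open>A\<close> holds the finite roots
  with multiplicity, \<open>e\<close> is the multiplicity of the root at infinity.\<close>

lemma homog_splits:
  assumes "q \<noteq> 0" "degree q \<le> d"
  obtains c A e where "c \<noteq> 0" "d = e + size A"
    "homog x y d q = Cst c * y ^ e * (\<Prod>a\<in>#A. x - Cst a * y)"
proof -
  obtain A where A: "size A = degree q" "q = smult (lead_coeff q) (\<Prod>a\<in>#A. [:- a, 1:])"
    using alg_closed_imp_factorization[OF assms(1)] by blast
  let ?P = "\<Prod>a\<in>#A. [:- a, 1:]"
  have "homog x y d q = Cst (lead_coeff q) * homog x y d ?P"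
    by (subst A(2)) (rule homog_smult)
  also have "homog x y d ?P = y ^ (d - size A) * homog x y (size A) ?P"
    using homog_power_mult[of ?P "size A" y "d - size A" x] homog_factors[of A x y] A assms by simp
  also have "homog x y (size A) ?P = (\<Prod>a\<in>#A. x - Cst a * y)"
    by (simp add: homog_factors)
  finally show thesis
    using assms A by (intro that[of "lead_coeff q" "d - size A" A]) (auto simp: mult.assoc)
qed

section \<open>Homogeneous ideals of ternary forms\<close>

text \<open>Coordinates on a plane: \<open>Var 1\<close> will be traded for the linear form defining
  the plane.\<close>

abbreviation tern :: "nat \<Rightarrow> poly4 set" where
  "tern d \<equiv> hf {Var 2, Var 3, Var 4} d"

text \<open>The degree \<open>n\<close> part of the ideal generated by a set \<open>G\<close> of pairs of a degree and a form
  of that degree.\<close>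

inductive gideal :: "(nat \<times> poly4) set \<Rightarrow> nat \<Rightarrow> poly4 \<Rightarrow> bool" for G where
  zero: "gideal G n 0"
| add: "gideal G n p \<Longrightarrow> gideal G n q \<Longrightarrow> gideal G n (p + q)"
| gen: "(e, w) \<in> G \<Longrightarrow> a \<in> tern k \<Longrightarrow> n = k + e \<Longrightarrow> gideal G n (w * a)"

lemma gideal_mono: "gideal G n p \<Longrightarrow> G \<subseteq> G' \<Longrightarrow> gideal G' n p"
  by (induction rule: gideal.induct) (auto intro: gideal.intros)

lemma gideal_mult: "gideal G n p \<Longrightarrow> s \<in> tern k \<Longrightarrow> gideal G (k + n) (s * p)"
proof (induction rule: gideal.induct)
  case (gen e w a k' n)
  then have "gideal G (k + n) (w * (s * a))"
    by (intro gideal.gen[of e w _ _ "k + k'"]) (auto intro: hf_mult)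
  then show ?case by (simp add: mult.left_commute)
qed (auto simp: distrib_left intro: gideal.intros)

lemma gideal_Cst_mult: "gideal G n p \<Longrightarrow> gideal G n (Cst c * p)"
  using gideal_mult[of G n p "Cst c" 0] by (simp add: hf_const)

lemma gideal_diff: "gideal G n p \<Longrightarrow> gideal G n q \<Longrightarrow> gideal G n (p - q)"
  using gideal.add[of G n p "- q"] gideal_Cst_mult[of G n q "-1"]
  by (simp only: single_uminus single_one mult_minus1 add_uminus_conv_diff)

lemma gideal_sum: "(\<And>k. k \<in> K \<Longrightarrow> gideal G n (f k)) \<Longrightarrow> gideal G n (sum f K)"
  by (induction K rule: infinite_finite_induct) (auto intro: gideal.intros)

lemma gideal_base: "(e, w) \<in> G \<Longrightarrow> gideal G e w"
  using gideal.gen[of e w G 1 0 e] by (simp add: hf_one)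

lemma gideal_tern:
  assumes "\<And>e w. (e, w) \<in> G \<Longrightarrow> w \<in> tern e" "gideal G n p"
  shows "p \<in> tern n"
  using assms(2)
proof (induction rule: gideal.induct)
  case (gen e w a k n)
  then show ?case using assms(1)[OF gen(1)] hf_mult[of w _ e a k] by (simp add: add.commute)
qed (auto intro: hf_intros)

text \<open>Since \<open>s\<close> moves \<open>P\<close> into the ideal of \<open>G\<close>, one
  multiplication by \<open>s\<close> disposes of the generator \<open>P\<close>. This is applied
  with \<open>P\<close> a product of linear forms and \<open>s\<close> a power of
  \<open>Var 2\<close>.\<close>

lemma gideal_eliminate:
  assumes "gideal (insert (k, P) G) n p" "gideal G (e + k) (s * P)" "s \<in> tern e"
  shows "gideal G (e + n) (s * p)"
  using assms(1)
proof (induction rule: gideal.induct)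
  case (gen e' w a k' n)
  show ?case
  proof (cases "(e', w) = (k, P)")
    case True
    then show ?thesis using gideal_mult[OF assms(2), of a k'] gen by (simp add: ac_simps)
  next
    case False
    then have "gideal G n (w * a)" using gen by (auto intro: gideal.gen)
    then show ?thesis using assms(3) by (rule gideal_mult)
  qed
qed (auto simp: distrib_left intro: gideal.intros)

text \<open>The product of the ideals (G, x) and (G, P) lies in (G, x P): in a product of two
  generators either one factor comes from \<open>G\<close> or the product is
  \<open>x * P\<close>.\<close>

lemma gideal_insert_mult:
  assumes G: "\<And>e w. (e, w) \<in> G \<Longrightarrow> w \<in> tern e" and x: "x \<in> tern j" and P: "P \<in> tern k"
    and "gideal (insert (j, x) G) n p" "gideal (insert (k, P) G) n' p'"
  shows "gideal (insert (j + k, x * P) G) (n + n') (p * p')"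
  using assms(4)
proof (induction rule: gideal.induct)
  case (gen e w a i n)
  have p': "p' \<in> tern n'" using assms(5) by (rule gideal_tern[rotated]) (use G P in auto)
  show ?case
  proof (cases "(e, w) = (j, x)")
    case False
    then have "gideal (insert (j + k, x * P) G) (n' + n) (p' * (w * a))"
      using gen p' by (intro gideal_mult gideal.gen[of e w _ a i]) auto
    then show ?thesis by (simp add: ac_simps)
  next
    case True
    have "gideal (insert (j + k, x * P) G) (i + j + n') (x * a * q)"
      if "gideal (insert (k, P) G) n' q" for q n'
      using that
    proof (induction rule: gideal.induct)
      case (gen e' w' b i' n')
      show ?case
      proof (cases "(e', w') = (k, P)")
        case True
        then have "gideal (insert (j + k, x * P) G) (i + j + n') ((x * P) * (a * b))"
          using gen \<open>a \<in> tern i\<close> by (intro gideal.gen[of "j + k" _ _ _ "i + i'"]) (auto intro: hf_mult)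
        then show ?thesis using True by (simp add: ac_simps)
      next
        case False
        then have wb: "gideal G n' (w' * b)" using gen by (auto intro: gideal.gen)
        have "gideal (insert (j + k, x * P) G) (i + j + n') (x * a * (w' * b))"
        proof -
          have "x * a \<in> tern (j + i)" using x \<open>a \<in> tern i\<close> by (rule hf_mult)
          from gideal_mult[OF wb this] show ?thesis
            by (auto simp: add.commute intro: gideal_mono)
        qed
        then show ?thesis .
      qed
    qed (auto simp: distrib_left intro: gideal.intros)
    from this[OF assms(5)] show ?thesis using True gen by simp
  qed
qed (auto simp: distrib_right intro: gideal.intros)

text \<open>Algebraic form of the fact that a function vanishing on the common zeros of
  \<open>G\<close> and each factor vanishes on those of \<open>G\<close> and the product. The
  exponents add up.\<close>

lemma gideal_prod:
  assumes G: "\<And>e w. (e, w) \<in> G \<Longrightarrow> w \<in> tern e" and m: "m \<in> tern 1"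
    and "\<And>a. a \<in># A \<Longrightarrow> \<xi> a \<in> tern 1 \<and> (\<exists>n. gideal (insert (1, \<xi> a) G) n (m ^ n))"
  shows "(\<Prod>a\<in>#A. \<xi> a) \<in> tern (size A) \<and>
    (\<exists>n. gideal (insert (size A, \<Prod>a\<in>#A. \<xi> a) G) n (m ^ n))"
  using assms(3)
proof (induction A)
  case empty
  have "gideal (insert (0, 1) G) 0 1" by (intro gideal_base) auto
  then show ?case by (auto simp: hf_one intro!: exI[of _ 0])
next
  case (add a A)
  then have IH: "(\<Prod>a\<in>#A. \<xi> a) \<in> tern (size A)"
      "\<exists>n. gideal (insert (size A, \<Prod>a\<in>#A. \<xi> a) G) n (m ^ n)"
    and a: "\<xi> a \<in> tern 1" "\<exists>n. gideal (insert (1, \<xi> a) G) n (m ^ n)"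
    using add.IH add.prems by simp_all
  then obtain n n' where n: "gideal (insert (1, \<xi> a) G) n (m ^ n)" "\<xi> a \<in> tern 1"
    "gideal (insert (size A, \<Prod>a\<in>#A. \<xi> a) G) n' (m ^ n')" "(\<Prod>a\<in>#A. \<xi> a) \<in> tern (size A)"
    by blast
  have "gideal (insert (1 + size A, \<xi> a * (\<Prod>a\<in>#A. \<xi> a)) G) (n + n') (m ^ n * m ^ n')"
    by (rule gideal_insert_mult[OF G n(2) n(4) n(1) n(3)])
  moreover have "\<xi> a * (\<Prod>a\<in>#A. \<xi> a) \<in> tern (1 + size A)" using n by (intro hf_mult)
  ultimately show ?case by (auto simp: power_add intro!: exI[of _ "n + n'"])
qed

section \<open>Ternary cubics without common zeros\<close>

text \<open>The line \<open>m = 0\<close> will serve as line at infinity, and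
  \<open>pt 0 0 1\<close> as reference point on it. Ternary forms do not see the coordinate
  1.\<close>

definition pt :: "complex \<Rightarrow> complex \<Rightarrow> complex \<Rightarrow> complex ^ 4" where
  "pt m y x = (\<chi> i. if i = 2 then m else if i = 3 then y else if i = 4 then x else 0)"

lemma pt_nth [simp]: "pt m y x $ 2 = m" "pt m y x $ 3 = y" "pt m y x $ 4 = x"
  by (simp_all add: pt_def)

text \<open>The restrictions of \<open>f\<close> and \<open>g\<close> to the line \<open>Var 2 = 0\<close> have no common zero.\<close>

locale cubic_pair =
  fixes f g f1 g1 :: poly4 and fq gq r s :: "complex poly"
  assumes f_eq: "f = homog (Var 4) (Var 3) 3 fq + Var 2 * f1" and f1: "f1 \<in> tern 2"
    and g_eq: "g = homog (Var 4) (Var 3) 3 gq + Var 2 * g1" and g1: "g1 \<in> tern 2"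
    and deg_fq: "degree fq = 3" and deg_gq: "degree gq \<le> 3" and bezout: "r * fq + s * gq = 1"
begin

abbreviation bin :: "nat \<Rightarrow> complex poly \<Rightarrow> poly4" where
  "bin \<equiv> homog (Var 4) (Var 3)"

lemma Var_tern: "Var 2 \<in> tern (Suc 0)" "Var 3 \<in> tern (Suc 0)" "Var 4 \<in> tern (Suc 0)"
  by (auto intro: hf_generator)

lemma bin_tern: "bin d q \<in> tern d"
  by (rule hf_mono[OF _ homog_in]) auto

lemma tern_split:
  assumes "u \<in> tern (Suc d)"
  obtains q u1 where "degree q \<le> Suc d" "u = bin (Suc d) q + Var 2 * u1" "u1 \<in> tern d"
proof -
  obtain u0 u1 where "u0 \<in> hf {Var 3, Var 4} (Suc d)" "u1 \<in> tern d" "u = u0 + Var 2 * u1"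
    by (rule hf_insert_split[OF assms])
  moreover from this(1) obtain q where "degree q \<le> Suc d" "u0 = bin (Suc d) q"
    using homog_exists[of u0 "Var 4" "Var 3" "Suc d"] by (auto simp: insert_commute)
  ultimately show thesis using that by blast
qed

lemma Var2_mult_tern: "u \<in> tern d \<Longrightarrow> Var 2 * u \<in> tern (Suc d)"
  by (rule hf_gen) auto

lemma f_tern: "f \<in> tern 3" and g_tern: "g \<in> tern 3"
  unfolding f_eq g_eq using Var2_mult_tern[OF f1] Var2_mult_tern[OF g1]
  by (auto intro!: hf_add bin_tern simp: numeral_3_eq_3)

text \<open>Two coprime binary cubics generate all binary forms of degree at least 5; lifting the
  coefficients from the line \<open>Var 2 = 0\<close> to the plane leaves a multiple of
  \<open>Var 2\<close>.\<close>

lemma tern_reduce: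
  assumes "u \<in> tern (k + 5)"
  obtains a b u' where "a \<in> tern (k + 2)" "b \<in> tern (k + 2)" "u' \<in> tern (k + 4)"
    "u = a * f + b * g + Var 2 * u'"
proof -
  have Suc_eq: "k + 5 = Suc (k + 4)" by simp
  obtain uq u1 where u: "degree uq \<le> k + 5" "u = bin (k + 5) uq + Var 2 * u1" "u1 \<in> tern (k + 4)"
    by (rule tern_split[OF assms[unfolded Suc_eq], folded Suc_eq])
  have fq0: "fq \<noteq> 0" using deg_fq by auto
  \<comment> \<open>The cofactor of \<open>gq\<close> is reduced modulo \<open>fq\<close>, so that
    \<open>b * gq\<close> has degree at most 5. This bounds \<open>a\<close>, and it is where the 5
    comes from.\<close>
  define b where "b = (uq * s) mod fq"
  define a where "a = uq * r + ((uq * s) div fq) * gq"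
  have b: "degree b \<le> 2" unfolding b_def using deg_fq degree_mod_less[OF fq0, of "uq * s"] by auto
  have "uq = uq * (r * fq + s * gq)" using bezout by simp
  also have "\<dots> = uq * r * fq + (uq * s) * gq" by (simp add: algebra_simps)
  also have "\<dots> = uq * r * fq + (((uq * s) div fq) * fq + b) * gq"
    unfolding b_def div_mult_mod_eq ..
  also have "\<dots> = a * fq + b * gq" by (simp add: a_def algebra_simps)
  finally have ab: "uq = a * fq + b * gq" .
  have "degree (b * gq) \<le> k + 5" using b deg_gq degree_mult_le[of b gq] by simp
  then have "degree (a * fq) \<le> k + 5"
    using ab u(1) degree_diff_le[of uq "k + 5" "b * gq"] by simp
  then have a: "degree a \<le> k + 2" using fq0 deg_fq by (cases "a = 0") (auto simp: degree_mult_eq)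
  have "bin (k + 2 + 3) uq = bin (k + 2) a * bin 3 fq + bin (k + 2) b * bin 3 gq"
    using a b deg_fq deg_gq by (subst ab, subst homog_add, subst (1 2) homog_mult) auto
  then have "bin (k + 5) uq = bin (k + 2) a * bin 3 fq + bin (k + 2) b * bin 3 gq"
    by (simp add: ac_simps)
  then have u_eq: "u = bin (k + 2) a * f + bin (k + 2) b * g
      + Var 2 * (u1 - bin (k + 2) a * f1 - bin (k + 2) b * g1)"
    by (simp add: u(2) f_eq g_eq algebra_simps)
  have mult: "bin (k + 2) q * h \<in> tern (k + 4)" if "h \<in> tern 2" for q h
    using hf_mult[OF bin_tern that, of "k + 2" q] by (simp add: eval_nat_numeral)
  show thesis
    by (rule that[OF bin_tern bin_tern _ u_eq]) (intro hf_diff mult u f1 g1)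
qed

text \<open>On the line \<open>Var 2 = 0\<close> the only syzygies of the coprime cubics are the
  multiples of \<open>(- gq, fq)\<close>. Once these are subtracted, the coefficients are divisible
  by \<open>Var 2\<close>.\<close>

lemma Var2_cancel:
  assumes "a \<in> tern (k + 3)" "b \<in> tern (k + 3)" "Var 2 * u = a * f + b * g"
  obtains a' b' where "a' \<in> tern (k + 2)" "b' \<in> tern (k + 2)" "u = a' * f + b' * g"
proof -
  have Suc_eq: "k + 3 = Suc (k + 2)" by simp
  obtain aq a1 where a: "degree aq \<le> k + 3" "a = bin (k + 3) aq + Var 2 * a1" "a1 \<in> tern (k + 2)"
    by (rule tern_split[OF assms(1)[unfolded Suc_eq], folded Suc_eq])
  obtain bq b1 where b: "degree bq \<le> k + 3" "b = bin (k + 3) bq + Var 2 * b1" "b1 \<in> tern (k + 2)"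
    by (rule tern_split[OF assms(2)[unfolded Suc_eq], folded Suc_eq])
  \<comment> \<open>On \<open>Var 2 = 0\<close> the left hand side of the relation vanishes; the
    affine points of that line suffice for a polynomial identity.\<close>
  have "poly (aq * fq + bq * gq) s = 0" for s
  proof -
    have "eval_poly (Var 2 * u) (pt 0 1 s) = eval_poly (a * f + b * g) (pt 0 1 s)"
      using assms(3) by simp
    then show ?thesis using a b deg_fq deg_gq by (simp add: f_eq g_eq eval_homog)
  qed
  then have rel: "aq * fq + bq * gq = 0" by (simp add: poly_eq_poly_eq_iff[symmetric] fun_eq_iff)
  then have "bq * gq = (- aq) * fq" by (simp add: eq_neg_iff_add_eq_0 add.commute)
  then have "fq dvd bq * gq" by (metis dvd_triv_right)
  then have "fq dvd bq * (r * fq) + s * (bq * gq)"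
    by (intro dvd_add dvd_mult[of fq "bq * gq"]) auto
  also have "bq * (r * fq) + s * (bq * gq) = bq * (r * fq + s * gq)" by (simp add: algebra_simps)
  finally have "fq dvd bq" using bezout by simp
  then obtain t where t: "bq = t * fq" by (metis dvdE mult.commute)
  have fq0: "fq \<noteq> 0" using deg_fq by auto
  have "(aq + t * gq) * fq = 0" using rel by (simp add: t algebra_simps)
  then have aq: "aq = - t * gq" using fq0 by (simp add: eq_neg_iff_add_eq_0)
  have dt: "degree t \<le> k" using b(1) fq0 deg_fq by (cases "t = 0") (auto simp: t degree_mult_eq)
  have ta: "bin (k + 3) aq = - bin k t * bin 3 gq"
    using homog_mult[of "- t" k gq 3] dt deg_gq by (simp add: aq homog_uminus)
  have tb: "bin (k + 3) bq = bin k t * bin 3 fq"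
    using homog_mult[of t k fq 3] dt deg_fq by (simp add: t)
  \<comment> \<open>With \<open>T = bin k t\<close> one has \<open>a = - T * g + Var 2 * a'\<close>
    and \<open>b = T * f + Var 2 * b'\<close>; the terms with \<open>T\<close> cancel in
    \<open>a * f + b * g\<close>.\<close>
  define a' where "a' = a1 + bin k t * g1"
  define b' where "b' = b1 - bin k t * f1"
  have "Var 2 * u = Var 2 * (a' * f + b' * g)"
    unfolding assms(3) a b ta tb a'_def b'_def by (simp add: f_eq g_eq algebra_simps)
  moreover have "Var 2 \<noteq> 0"
    using eval_poly_Var[of 2 "pt 1 0 0"] by (metis eval_poly_zero pt_nth(1) zero_neq_one)
  ultimately have "u = a' * f + b' * g" by (simp only: mult_cancel_left) simp
  moreover have "a' \<in> tern (k + 2)" "b' \<in> tern (k + 2)"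
    unfolding a'_def b'_def
    using hf_add[OF a(3) hf_mult[OF bin_tern g1]] hf_diff[OF b(3) hf_mult[OF bin_tern f1]] by auto
  ultimately show thesis using that by blast
qed

text \<open>Quartics remain because \<open>tern_reduce\<close> applies from degree 5 on.\<close>

lemma tern_reduce_iterated:
  "u \<in> tern (4 + k) \<Longrightarrow>
    \<exists>a\<in>tern (k + 1). \<exists>b\<in>tern (k + 1). \<exists>s\<in>tern 4. u = a * f + b * g + Var 2 ^ k * s"
proof (induction k arbitrary: u)
  case 0
  then show ?case by (intro bexI[of _ 0] bexI[of _ u]) (auto intro: hf_zero)
next
  case (Suc k)
  then have "u \<in> tern (k + 5)" by (simp add: add.commute)
  then obtain a b u' where u: "a \<in> tern (k + 2)" "b \<in> tern (k + 2)" "u' \<in> tern (4 + k)"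
    "u = a * f + b * g + Var 2 * u'"
    using tern_reduce[of u k] unfolding add.commute[of 4 k] by blast
  obtain a' b' s where s: "a' \<in> tern (k + 1)" "b' \<in> tern (k + 1)" "s \<in> tern 4"
    "u' = a' * f + b' * g + Var 2 ^ k * s"
    using Suc.IH[OF u(3)] by blast
  have "u = (a + Var 2 * a') * f + (b + Var 2 * b') * g + Var 2 ^ Suc k * s"
    unfolding u(4) s(4) by (simp add: algebra_simps)
  moreover have "a + Var 2 * a' \<in> tern (Suc k + 1)" "b + Var 2 * b' \<in> tern (Suc k + 1)"
    using u s Var2_mult_tern[of a' "k + 1"] Var2_mult_tern[of b' "k + 1"]
    by (auto intro!: hf_add)
  ultimately show ?case using s(3) by blast
qed

text \<open>Modulo \<open>f\<close> and \<open>g\<close> all forms of degree \<open>4 + n\<close> are multiples of quartics by \<open>Var 2 ^ n\<close>, so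
  more binary monomials than the dimension of the space of quartics are dependent.\<close>

lemma binary_eliminant:
  obtains n q where "q \<noteq> 0" "degree q \<le> n"
    "gideal {(3, f), (3, g)} n (homog (Var 3) (Var 2) n q)"
proof -
  let ?G = "{(3, f), (3, g)}"
  obtain E where E: "finite E" "tern 4 \<subseteq> poly4.span E"
    using hf_finite_span[of "{Var 2, Var 3, Var 4}" 4] by auto
  \<comment> \<open>There are \<open>n + 1\<close> monomials \<open>u 0\<close>, ...,
    \<open>u n\<close> against \<open>n\<close> elements spanning the quartics.\<close>
  define n where "n = card E"
  define u where "u i = Var 3 ^ i * Var 2 ^ (4 + n - i)" for i
  have "u i \<in> tern (4 + n)" if "i \<le> n" for i
  proof -
    have "u i \<in> tern (i * Suc 0 + (4 + n - i) * Suc 0)"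
      unfolding u_def by (intro hf_mult hf_power Var_tern)
    then show ?thesis using that by simp
  qed
  then have "\<forall>i\<in>{..n}. \<exists>a b s. a \<in> tern (n + 1) \<and> b \<in> tern (n + 1) \<and> s \<in> tern 4 \<and>
      u i = a * f + b * g + Var 2 ^ n * s"
    using tern_reduce_iterated by (metis atMost_iff)
  then obtain a b s where abs: "\<And>i. i \<le> n \<Longrightarrow> a i \<in> tern (n + 1) \<and> b i \<in> tern (n + 1) \<and> s i \<in> tern 4 \<and>
      u i = a i * f + b i * g + Var 2 ^ n * s i"
    by (metis atMost_iff)
  have "\<exists>\<sigma>. s i = (\<Sum>e\<in>E. Cst (\<sigma> e) * e)" if "i \<le> n" for i
  proof -
    have "s i \<in> poly4.span E" using abs[OF that] E by blast
    then show ?thesis unfolding poly4.span_finite[OF E(1)] pscale_eq by blast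
  qed
  then have "\<forall>i\<in>{..n}. \<exists>\<sigma>. s i = (\<Sum>e\<in>E. Cst (\<sigma> e) * e)" by simp
  from bchoice[OF this] obtain \<sigma> where \<sigma>: "\<And>i. i \<le> n \<Longrightarrow> s i = (\<Sum>e\<in>E. Cst (\<sigma> i e) * e)"
    by blast
  have "card E < card {..n}" by (simp add: n_def)
  then obtain x where x: "\<exists>i\<in>{..n}. x i \<noteq> 0" "\<And>e. e \<in> E \<Longrightarrow> (\<Sum>i\<le>n. x i * \<sigma> i e) = 0"
    using underdetermined_system[OF E(1), of "{..n}" \<sigma>] by auto
  have "(\<Sum>i\<le>n. Cst (x i) * s i) = (\<Sum>i\<le>n. \<Sum>e\<in>E. Cst (x i * \<sigma> i e) * e)"
    by (intro sum.cong) (auto simp: \<sigma> sum_distrib_left mult_single simp flip: mult.assoc)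
  also have "\<dots> = (\<Sum>e\<in>E. Cst (\<Sum>i\<le>n. x i * \<sigma> i e) * e)"
  proof (subst sum.swap, intro sum.cong refl)
    fix e
    have "Cst (sum h K) = (\<Sum>i\<in>K. Cst (h i))" for h :: "nat \<Rightarrow> complex" and K
      by (induction K rule: infinite_finite_induct) (auto simp: single_add)
    then show "(\<Sum>i\<le>n. Cst (x i * \<sigma> i e) * e) = Cst (\<Sum>i\<le>n. x i * \<sigma> i e) * e"
      by (simp add: sum_distrib_right)
  qed
  also have "\<dots> = 0" using x by simp
  finally have s0: "(\<Sum>i\<le>n. Cst (x i) * s i) = 0" .
  \<comment> \<open>The dependence eliminates \<open>Var 4\<close> from \<open>f\<close> and
    \<open>g\<close>, in place of a resultant.\<close>
  define q where "q = (\<Sum>i\<le>n. monom (x i) i)"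
  have coeff_q: "poly.coeff q i = (if i \<le> n then x i else 0)" for i
    by (simp add: q_def coeff_sum)
  have "homog (Var 3) (Var 2) (4 + n) q = (\<Sum>i\<le>n. Cst (x i) * u i)"
    unfolding homog_def u_def by (rule sum.mono_neutral_cong_right) (auto simp: coeff_q mult.assoc)
  also have "\<dots> = (\<Sum>i\<le>n. Cst (x i) * (f * a i + g * b i)) + Var 2 ^ n * (\<Sum>i\<le>n. Cst (x i) * s i)"
    unfolding sum_distrib_left sum.distrib[symmetric]
  proof (intro sum.cong refl)
    fix i assume "i \<in> {..n}"
    then have "u i = a i * f + b i * g + Var 2 ^ n * s i" using abs by simp
    then show "Cst (x i) * u i = Cst (x i) * (f * a i + g * b i) + Var 2 ^ n * (Cst (x i) * s i)"
      by (simp add: algebra_simps)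
  qed
  finally have eq: "homog (Var 3) (Var 2) (4 + n) q = (\<Sum>i\<le>n. Cst (x i) * (f * a i + g * b i))"
    using s0 by simp
  have "gideal ?G (4 + n) (Cst (x i) * (f * a i + g * b i))" if "i \<le> n" for i
    using abs[OF that]
    by (intro gideal_Cst_mult gideal.add gideal.gen[of 3 _ _ _ "n + 1"]) auto
  then have "gideal ?G (4 + n) (homog (Var 3) (Var 2) (4 + n) q)"
    unfolding eq by (intro gideal_sum) auto
  moreover have "q \<noteq> 0" using x(1) coeff_q by (metis atMost_iff coeff_0)
  moreover have "degree q \<le> 4 + n" by (rule degree_le) (simp add: coeff_q)
  ultimately show thesis using that by blast
qed

end

section \<open>Base point free linear systems of plane cubics\<close>

lemma hf_singleton:
  "p \<in> hf {m} d \<Longrightarrow> \<exists>c. p = Cst c * m ^ d"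
proof (induction rule: hf_induct)
  case (zero d) then show ?case by (intro exI[of _ 0]) auto
next
  case (const c) then show ?case by auto
next
  case (add d p q)
  then obtain b c where "p = Cst b * m ^ d" "q = Cst c * m ^ d" by blast
  then show ?case by (intro exI[of _ "b + c"]) (simp add: single_add distrib_right)
next
  case (gen x d p) then show ?case by (auto simp: mult.left_commute)
qed

lemma eval_tern_cong:
  assumes "p \<in> tern d" "v $ 2 = w $ 2" "v $ 3 = w $ 3" "v $ 4 = w $ 4"
  shows "eval_poly p v = eval_poly p w"
  using assms(1) by (induction rule: hf_induct) (use assms in auto)

text \<open>A vector space over an infinite field is not a finite union of proper subspaces: at each
  point at most one value of \<open>s\<close> makes \<open>g + Cst s * w\<close> vanish.\<close>

lemma avoid_finitely_many_points:
  assumes "finite P" and "0 \<in> W" and "\<And>p q. p \<in> W \<Longrightarrow> q \<in> W \<Longrightarrow> p + q \<in> W"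
    and "\<And>c p. p \<in> W \<Longrightarrow> Cst c * p \<in> W" and "\<And>v. v \<in> P \<Longrightarrow> \<exists>w\<in>W. eval_poly w v \<noteq> 0"
  shows "\<exists>w\<in>W. \<forall>v\<in>P. eval_poly w v \<noteq> 0"
  using assms(1,5)
proof (induction P rule: finite_induct)
  case empty
  then show ?case using assms(2) by auto
next
  case (insert v P)
  then obtain g w where g: "g \<in> W" "\<forall>v\<in>P. eval_poly g v \<noteq> 0" and w: "w \<in> W" "eval_poly w v \<noteq> 0"
    by blast
  have "finite ((\<lambda>u. - eval_poly g u / eval_poly w u) ` insert v P)" using insert by simp
  then obtain s :: complex where s: "s \<notin> (\<lambda>u. - eval_poly g u / eval_poly w u) ` insert v P" "s \<noteq> 0"
    using ex_new_if_finite[of "insert 0 ((\<lambda>u. - eval_poly g u / eval_poly w u) ` insert v P)"]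
      infinite_UNIV_char_0 by auto
  have "eval_poly (g + Cst s * w) u \<noteq> 0" if u: "u \<in> insert v P" for u
  proof (cases "eval_poly w u = 0")
    case True
    then show ?thesis using u g w by auto
  next
    case False
    then have "s \<noteq> - eval_poly g u / eval_poly w u" using s u by auto
    then show ?thesis using False by (auto simp: field_simps add_eq_0_iff)
  qed
  then show ?case using assms g w by (intro bexI[of _ "g + Cst s * w"]) auto
qed

text \<open>The whole linear system is kept rather than three generators, so that a member can be
  chosen for each point separately.\<close>

locale ternary_cubics =
  fixes W :: "poly4 set"
  assumes W_tern: "w \<in> W \<Longrightarrow> w \<in> tern 3"
    and W_zero: "0 \<in> W"
    and W_add: "p \<in> W \<Longrightarrow> q \<in> W \<Longrightarrow> p + q \<in> W"
    and W_Cst_mult: "p \<in> W \<Longrightarrow> Cst c * p \<in> W"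
    and no_zero: "(m, y, x) \<noteq> (0, 0, 0) \<Longrightarrow> \<exists>w\<in>W. eval_poly w (pt m y x) \<noteq> 0"
begin

abbreviation cubics :: "(nat \<times> poly4) set" where
  "cubics \<equiv> {3} \<times> W"

lemma tern_3_split:
  assumes "w \<in> W"
  obtains q w1 where "degree q \<le> 3" "w = homog (Var 4) (Var 3) 3 q + Var 2 * w1" "w1 \<in> tern 2"
proof -
  obtain w0 w1 where "w0 \<in> hf {Var 3, Var 4} (Suc 2)" "w1 \<in> tern 2" "w = w0 + Var 2 * w1"
    by (rule hf_insert_split[of w "Var 2" "{Var 3, Var 4}" 2]) (use W_tern[OF assms] in auto)
  moreover from this(1) obtain q where "degree q \<le> 3" "w0 = homog (Var 4) (Var 3) 3 q"
    using homog_exists[of w0 "Var 4" "Var 3" 3] by (auto simp: insert_commute)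
  ultimately show thesis using that by blast
qed

text \<open>Taking \<open>f\<close> nonzero at \<open>pt 0 0 1\<close> gives \<open>fq\<close> full
  degree and puts all zeros of \<open>f\<close> on the line \<open>Var 2 = 0\<close> into the chart
  \<open>Var 3 = 1\<close>; a general \<open>g\<close> avoids them.\<close>

lemma cubic_pair_exists:
  obtains f g f1 g1 fq gq r s where "f \<in> W" "g \<in> W" "cubic_pair f g f1 g1 fq gq r s"
proof -
  obtain f where f: "f \<in> W" "eval_poly f (pt 0 0 1) \<noteq> 0" using no_zero[of 0 0 1] by auto
  obtain fq f1 where fq: "degree fq \<le> 3" "f = homog (Var 4) (Var 3) 3 fq + Var 2 * f1" "f1 \<in> tern 2"
    using tern_3_split[OF f(1)] .
  have "poly.coeff fq 3 \<noteq> 0" using f(2) by (simp add: fq(2) eval_homog_infinity)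
  then have deg: "degree fq = 3" using fq(1) le_degree[of fq 3] by linarith
  then have fq0: "fq \<noteq> 0" by auto
  define P where "P = pt 0 1 ` {s. poly fq s = 0}"
  have "finite P" unfolding P_def using fq0 by (intro finite_imageI poly_roots_finite)
  moreover have "\<exists>w\<in>W. eval_poly w v \<noteq> 0" if "v \<in> P" for v
    using that no_zero[of 0 1] by (auto simp: P_def)
  ultimately obtain g where g: "g \<in> W" "\<forall>v\<in>P. eval_poly g v \<noteq> 0"
    using avoid_finitely_many_points[OF _ W_zero W_add W_Cst_mult, of P] by blast
  obtain gq g1 where gq: "degree gq \<le> 3" "g = homog (Var 4) (Var 3) 3 gq + Var 2 * g1" "g1 \<in> tern 2"
    using tern_3_split[OF g(1)] .
  have root: "poly gq z \<noteq> 0" if "poly fq z = 0" for z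
  proof -
    have "eval_poly g (pt 0 1 z) \<noteq> 0" using g that by (auto simp: P_def)
    then show ?thesis using gq(1) by (simp add: gq(2) eval_homog)
  qed
  \<comment> \<open>No common root, hence a constant gcd, hence a Bezout identity.\<close>
  have "gcd fq gq dvd fq" "gcd fq gq dvd gq" by auto
  then have "poly (gcd fq gq) z \<noteq> 0" for z
    using root by (metis dvdE mult_eq_0_iff poly_mult)
  then have "degree (gcd fq gq) = 0"
    using fundamental_theorem_of_algebra constant_degree by blast
  moreover have "gcd fq gq \<noteq> 0" using fq0 by simp
  ultimately have "is_unit (gcd fq gq)" using is_unit_iff_degree by blast
  then have "gcd fq gq = 1" by (metis is_unit_gcd coprime_imp_gcd_eq_1)
  then obtain r s where "r * fq + s * gq = 1"
    using bezout_coefficients_fst_snd[of fq gq] by metis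
  then have "cubic_pair f g f1 g1 fq gq r s"
    using fq gq deg by unfold_locales auto
  then show thesis using that f g by blast
qed

end

section \<open>The ideal of the cubics in degree 7\<close>

locale ternary_cubics_pair = ternary_cubics + cubic_pair +
  assumes fW: "f \<in> W" and gW: "g \<in> W"
begin

text \<open>The Nullstellensatz on the line \<open>Var 3 = \<beta> * Var 2\<close>: there
  \<open>f\<close> becomes a nonzero binary form, its finite linear factors lead to points
  \<open>pt 1 \<beta> a\<close>, and at each of these some member of \<open>W\<close> is
  nonzero.\<close>

lemma Var2_power_mod_linear:
  obtains n where "gideal (insert (1, Var 3 - Cst \<beta> * Var 2) cubics) n (Var 2 ^ n)"
proof -
  let ?\<eta> = "Var 3 - Cst \<beta> * Var 2"
  define G where "G = insert (1, ?\<eta>) cubics"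
  have lin: "Var i - Cst c * Var 2 \<in> tern 1" if "i \<in> {2, 3, 4}" for i c
    unfolding One_nat_def by (intro hf_diff hf_Cst_mult hf_generator) (use that in auto)
  have G: "w \<in> tern e" if "(e, w) \<in> G" for e w
    using that lin W_tern by (auto simp: G_def)
  have split: "\<exists>u0\<in>hf {Var 4, Var 2} (Suc d). \<exists>u1\<in>tern d. u = u0 + ?\<eta> * u1" if "u \<in> tern (Suc d)" for u d
  proof -
    have "Var 3 = ?\<eta> + Cst \<beta> * Var 2" by simp
    moreover have "?\<eta> + Cst \<beta> * Var 2 \<in> hf {?\<eta>, Var 4, Var 2} (Suc 0)"
      by (intro hf_add hf_Cst_mult hf_generator) auto
    ultimately have "{Var 2, Var 3, Var 4} \<subseteq> hf {?\<eta>, Var 4, Var 2} (Suc 0)"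
      by (auto intro: hf_generator)
    then have "u \<in> hf {?\<eta>, Var 4, Var 2} (Suc d)" using that by (rule hf_generators)
    then obtain u0 u1 where u: "u0 \<in> hf {Var 4, Var 2} (Suc d)" "u1 \<in> hf {?\<eta>, Var 4, Var 2} d" "u = u0 + ?\<eta> * u1"
      by (rule hf_insert_split)
    have "u1 \<in> tern d" using u(2)
      by (rule hf_generators[rotated]) (use lin[of 3] in \<open>auto intro: hf_generator\<close>)
    with u show ?thesis by blast
  qed
  have reduce: "gideal G (Suc d) u0" if "gideal G (Suc d) u" "u = u0 + ?\<eta> * u1" "u1 \<in> tern d" for u u0 u1 d
  proof -
    have "gideal G (Suc d) (?\<eta> * u1)" using that by (intro gideal.gen[of 1 _ _ _ d]) (auto simp: G_def)
    then show ?thesis using gideal_diff[OF that(1)] that(2) by fastforce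
  qed
  obtain f0 f2 where f0: "f0 \<in> hf {Var 4, Var 2} 3" "f = f0 + ?\<eta> * f2" "f2 \<in> tern 2"
    using split[of f 2] f_tern by auto
  have "gideal G 3 f" using fW by (intro gideal_base) (auto simp: G_def)
  then have f0G: "gideal G 3 f0" using reduce[of 2 f f0 f2] f0 by simp
  obtain q where q: "degree q \<le> 3" "f0 = homog (Var 4) (Var 2) 3 q"
    using homog_exists[OF f0(1)] by blast
  \<comment> \<open>Both \<open>Var 2\<close> and \<open>?\<eta>\<close> vanish at
    \<open>pt 0 0 1\<close>, so \<open>f\<close> and \<open>f0\<close> agree there; this makes
    \<open>q\<close> nonzero.\<close>
  have "eval_poly f (pt 0 0 1) = poly.coeff fq 3" by (simp add: f_eq eval_homog_infinity)
  moreover have "eval_poly f (pt 0 0 1) = poly.coeff q 3" by (simp add: f0(2) q(2) eval_homog_infinity)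
  ultimately have "poly.coeff q 3 \<noteq> 0" using deg_fq by (metis degree_0 leading_coeff_0_iff zero_neq_numeral)
  then have "q \<noteq> 0" by auto
  then obtain c A e where A: "c \<noteq> 0" "3 = e + size A"
    "f0 = Cst c * Var 2 ^ e * (\<Prod>a\<in>#A. Var 4 - Cst a * Var 2)"
    using homog_splits[OF _ q(1)] q(2) by metis
  let ?P = "\<Prod>a\<in>#A. Var 4 - Cst a * Var 2"
  have "gideal (insert (1, Var 4 - Cst a * Var 2) G) 3 (Var 2 ^ 3)" for a
  proof -
    let ?\<xi> = "Var 4 - Cst a * Var 2"
    \<comment> \<open>Modulo \<open>?\<eta>\<close> and \<open>?\<xi>\<close> every ternary cubic is
      a multiple of \<open>Var 2 ^ 3\<close>; for \<open>w\<close> the factor is its value at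
      \<open>pt 1 \<beta> a\<close>.\<close>
    obtain w where w: "w \<in> W" "eval_poly w (pt 1 \<beta> a) \<noteq> 0" using no_zero[of 1 \<beta> a] by auto
    obtain w0 w1 where w0: "w0 \<in> hf {Var 4, Var 2} 3" "w = w0 + ?\<eta> * w1" "w1 \<in> tern 2"
      using split[of w 2] W_tern[OF w(1)] by auto
    have "gideal G 3 w" using w by (intro gideal_base) (auto simp: G_def)
    then have w0G: "gideal G 3 w0" using reduce[of 2 w w0 w1] w0 by simp
    have "Var 4 = ?\<xi> + Cst a * Var 2" by simp
    moreover have "?\<xi> + Cst a * Var 2 \<in> hf {?\<xi>, Var 2} (Suc 0)"
      by (intro hf_add hf_Cst_mult hf_generator) auto
    ultimately have "{Var 4, Var 2} \<subseteq> hf {?\<xi>, Var 2} (Suc 0)"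
      by (auto intro: hf_generator)
    from hf_generators[OF this w0(1)] have "w0 \<in> hf {?\<xi>, Var 2} (Suc 2)" by simp
    then obtain u0 u1 where u: "u0 \<in> hf {Var 2} (Suc 2)" "u1 \<in> hf {?\<xi>, Var 2} 2" "w0 = u0 + ?\<xi> * u1"
      by (rule hf_insert_split)
    have u1: "u1 \<in> tern 2" using u(2)
      by (rule hf_generators[rotated]) (use lin[of 4] in \<open>auto intro: hf_generator\<close>)
    obtain c where c: "u0 = Cst c * Var 2 ^ 3" using hf_singleton[OF u(1)] by auto
    have "c \<noteq> 0" using w(2) by (auto simp: w0(2) u(3) c)
    have "gideal (insert (1, ?\<xi>) G) 3 (?\<xi> * u1)" using u1 by (intro gideal.gen[of 1 _ _ _ 2]) auto
    moreover have "gideal (insert (1, ?\<xi>) G) 3 w0" using w0G by (rule gideal_mono) auto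
    ultimately have "gideal (insert (1, ?\<xi>) G) 3 (Cst c * Var 2 ^ 3)"
      using gideal_diff[of _ 3 w0 "?\<xi> * u1"] u(3) c by simp
    from gideal_Cst_mult[OF this, of "1 / c"] show ?thesis
      using \<open>c \<noteq> 0\<close> by (simp add: mult_single flip: mult.assoc)
  qed
  moreover have "Var 4 - Cst a * Var 2 \<in> tern 1" for a by (rule lin) simp
  moreover have "Var 2 \<in> tern 1" using Var_tern(1) by simp
  ultimately obtain n where n: "gideal (insert (size A, ?P) G) n (Var 2 ^ n)"
    using gideal_prod[of G "Var 2" A "\<lambda>a. Var 4 - Cst a * Var 2", OF G] by blast
  \<comment> \<open>Up to a scalar this is \<open>f0\<close>, so multiplication by
    \<open>Var 2 ^ e\<close> removes the generator \<open>?P\<close>.\<close>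
  have "gideal G (e + size A) (Var 2 ^ e * ?P)"
    using gideal_Cst_mult[OF f0G, of "1 / c"] A by (simp add: mult_single flip: mult.assoc)
  moreover have "Var 2 ^ e \<in> tern e" using hf_power[OF Var_tern(1), of e] by simp
  ultimately have "gideal G (e + n) (Var 2 ^ e * Var 2 ^ n)"
    by (rule gideal_eliminate[OF n])
  then show thesis using that unfolding G_def power_add[symmetric] by blast
qed

text \<open>The same pattern one dimension up: the factors of the eliminant are
  \<open>Var 2\<close>, which does no harm, and linear forms settled by
  \<open>Var2_power_mod_linear\<close>.\<close>

lemma Var2_power_gideal:
  obtains n where "gideal cubics n (Var 2 ^ n)"
proof -
  obtain k q where q: "q \<noteq> 0" "degree q \<le> k" "gideal {(3, f), (3, g)} k (homog (Var 3) (Var 2) k q)"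
    using binary_eliminant .
  then have qW: "gideal cubics k (homog (Var 3) (Var 2) k q)"
    using fW gW by (auto intro: gideal_mono)
  obtain c A e where A: "c \<noteq> 0" "k = e + size A"
    "homog (Var 3) (Var 2) k q = Cst c * Var 2 ^ e * (\<Prod>a\<in>#A. Var 3 - Cst a * Var 2)"
    using homog_splits[OF q(1,2)] by metis
  let ?P = "\<Prod>a\<in>#A. Var 3 - Cst a * Var 2"
  have lin: "Var 3 - Cst a * Var 2 \<in> tern 1" for a
    unfolding One_nat_def by (intro hf_diff hf_Cst_mult hf_generator) auto
  have "\<exists>n. gideal (insert (1, Var 3 - Cst a * Var 2) cubics) n (Var 2 ^ n)" for a
    using Var2_power_mod_linear[of a] by blast
  then obtain n where n: "gideal (insert (size A, ?P) cubics) n (Var 2 ^ n)"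
    using gideal_prod[of cubics "Var 2" A "\<lambda>a. Var 3 - Cst a * Var 2"] lin W_tern Var_tern by auto
  have "gideal cubics (e + size A) (Var 2 ^ e * ?P)"
    using gideal_Cst_mult[OF qW, of "1 / c"] A by (simp add: mult_single flip: mult.assoc)
  moreover have "Var 2 ^ e \<in> tern e" using hf_power[OF Var_tern(1), of e] by simp
  ultimately have "gideal cubics (e + n) (Var 2 ^ e * Var 2 ^ n)"
    by (rule gideal_eliminate[OF n])
  then show thesis using that unfolding power_add[symmetric] by blast
qed

text \<open>Modulo \<open>f\<close> and \<open>g\<close> a form of large degree is a multiple of a
  high power of \<open>Var 2\<close>, which lies in the ideal.\<close>

lemma gideal_large_degree:
  obtains N where "N \<ge> 7" "\<And>u. u \<in> tern N \<Longrightarrow> gideal cubics N u"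
proof -
  obtain n where n: "gideal cubics n (Var 2 ^ n)" by (rule Var2_power_gideal)
  \<comment> \<open>Three more factors ensure \<open>N \<ge> 7\<close>.\<close>
  have "Var 2 ^ 3 \<in> tern 3" using hf_power[OF Var_tern(1), of 3] by simp
  from gideal_mult[OF n this] have n3: "gideal cubics (3 + n) (Var 2 ^ (3 + n))"
    by (simp add: power_add)
  have "gideal cubics (4 + (3 + n)) u" if ut: "u \<in> tern (4 + (3 + n))" for u
  proof -
    obtain a b s where u: "a \<in> tern (3 + n + 1)" "b \<in> tern (3 + n + 1)" "s \<in> tern 4"
      "u = a * f + b * g + Var 2 ^ (3 + n) * s"
      using tern_reduce_iterated[OF ut] by blast
    have "gideal cubics (4 + (3 + n)) (f * a)" "gideal cubics (4 + (3 + n)) (g * b)"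
      using u fW gW by (auto intro!: gideal.gen[of 3 _ _ _ "3 + n + 1"])
    moreover have "gideal cubics (4 + (3 + n)) (s * Var 2 ^ (3 + n))"
      using n3 u(3) by (rule gideal_mult)
    ultimately show ?thesis unfolding u(4) by (simp add: mult.commute gideal.add)
  qed
  then show thesis by (intro that[of "4 + (3 + n)"]) auto
qed

text \<open>The cofactor \<open>c\<close> of a generator \<open>w\<close> has degree
  \<open>k + 5\<close>, just enough for \<open>tern_reduce\<close>. The part of \<open>c\<close>
  divisible by \<open>Var 2\<close> keeps the factor \<open>w\<close>, so its quotient stays in the
  ideal.\<close>

lemma gideal_divide:
  assumes "gideal cubics n p" "n = k + 8"
  shows "\<exists>q a b. gideal cubics (k + 7) q \<and> a \<in> tern (k + 5) \<and> b \<in> tern (k + 5) \<and>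
    p = Var 2 * q + a * f + b * g"
  using assms
proof (induction rule: gideal.induct)
  case (zero n)
  show ?case by (intro exI[of _ 0]) (auto intro: gideal.zero hf_zero)
next
  case (add n p p')
  then obtain q a b q' a' b' where "gideal cubics (k + 7) q" "a \<in> tern (k + 5)" "b \<in> tern (k + 5)"
    "p = Var 2 * q + a * f + b * g" "gideal cubics (k + 7) q'" "a' \<in> tern (k + 5)" "b' \<in> tern (k + 5)"
    "p' = Var 2 * q' + a' * f + b' * g" by metis
  then show ?case
    by (intro exI[of _ "q + q'"] exI[of _ "a + a'"] exI[of _ "b + b'"])
      (auto simp: algebra_simps intro: gideal.add hf_add)
next
  case (gen e w c i n)
  then have w: "w \<in> W" "w \<in> tern 3" and i: "i = k + 5" using W_tern by auto
  obtain a b u where u: "a \<in> tern (k + 2)" "b \<in> tern (k + 2)" "u \<in> tern (k + 4)"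
    "c = a * f + b * g + Var 2 * u"
    using tern_reduce[of c k] gen i by metis
  have "gideal cubics (k + 7) (w * u)"
    using w u by (intro gideal.gen[of 3 _ _ _ "k + 4"]) auto
  moreover have "w * a \<in> tern (k + 5)" "w * b \<in> tern (k + 5)"
    using hf_mult[OF u(1) w(2)] hf_mult[OF u(2) w(2)]
    by (simp_all add: mult.commute[of w] eval_nat_numeral)
  moreover have "w * c = Var 2 * (w * u) + (w * a) * f + (w * b) * g"
    unfolding u(4) by (simp add: algebra_simps)
  ultimately show ?case by blast
qed

text \<open>\<open>Var 2 * u\<close> is divided within the ideal, then \<open>Var 2\<close> is
  cancelled modulo \<open>f\<close> and \<open>g\<close>. The descent ends in degree 7 because
  cofactors in degree 8 have degree 5.\<close>

lemma gideal_descend: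
  assumes "\<And>u. u \<in> tern (k + 8) \<Longrightarrow> gideal cubics (k + 8) u" and "u \<in> tern (k + 7)"
  shows "gideal cubics (k + 7) u"
proof -
  have "Var 2 * u \<in> tern (k + 8)" using Var2_mult_tern[OF assms(2)] by (simp add: eval_nat_numeral)
  then have "gideal cubics (k + 8) (Var 2 * u)" by (rule assms(1))
  then obtain q a b where q: "gideal cubics (k + 7) q" "a \<in> tern (k + 5)" "b \<in> tern (k + 5)"
    "Var 2 * u = Var 2 * q + a * f + b * g"
    using gideal_divide by blast
  have "Var 2 * (u - q) = a * f + b * g" using q(4) by (simp add: algebra_simps)
  moreover have "a \<in> tern (k + 2 + 3)" "b \<in> tern (k + 2 + 3)" using q by (simp_all add: eval_nat_numeral)
  ultimately obtain a' b' where ab: "a' \<in> tern (k + 2 + 2)" "b' \<in> tern (k + 2 + 2)" "u - q = a' * f + b' * g"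
    using Var2_cancel[of a "k + 2" b "u - q"] by metis
  have "gideal cubics (k + 7) (f * a')" "gideal cubics (k + 7) (g * b')"
    using ab fW gW by (auto intro!: gideal.gen[of 3 _ _ _ "k + 2 + 2"])
  then have "gideal cubics (k + 7) (q + (f * a' + g * b'))" using q by (intro gideal.add)
  moreover have "q + (f * a' + g * b') = u" using ab(3) by (simp add: algebra_simps)
  ultimately show ?thesis by simp
qed

lemma gideal_degree_7_pair: "u \<in> tern 7 \<Longrightarrow> gideal cubics 7 u"
proof -
  obtain N where N: "N \<ge> 7" "\<And>u. u \<in> tern N \<Longrightarrow> gideal cubics N u"
    using gideal_large_degree by metis
  have "\<forall>u\<in>tern (7::nat). gideal cubics 7 u" using N(1)
  proof (induction rule: inc_induct)
    case base
    then show ?case using N by blast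
  next
    case (step n)
    define k where "k = n - 7"
    have n: "n = k + 7" "Suc n = k + 8" using step.hyps by (simp_all add: k_def)
    show ?case using gideal_descend[of k] step.IH[unfolded n(2)] unfolding n(1) by blast
  qed
  then show "u \<in> tern 7 \<Longrightarrow> gideal cubics 7 u" by blast
qed

end

context ternary_cubics
begin

lemma gideal_degree_7:
  assumes "u \<in> tern 7"
  shows "gideal cubics 7 u"
proof -
  obtain f g f1 g1 fq gq r s where "f \<in> W" "g \<in> W" "cubic_pair f g f1 g1 fq gq r s"
    by (rule cubic_pair_exists)
  then interpret ternary_cubics_pair W f g f1 g1 fq gq r s
    by (simp add: ternary_cubics_pair_def ternary_cubics_pair_axioms_def ternary_cubics_axioms)
  show ?thesis using assms by (rule gideal_degree_7_pair)
qed

end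

section \<open>The Hilbert basis theorem\<close>

definition ideal :: "'a::comm_ring_1 set \<Rightarrow> bool" where
  "ideal I \<longleftrightarrow> 0 \<in> I \<and> (\<forall>x\<in>I. \<forall>y\<in>I. x + y \<in> I) \<and> (\<forall>x\<in>I. \<forall>r. r * x \<in> I)"

definition noetherian :: "'a::comm_ring_1 itself \<Rightarrow> bool" where
  "noetherian _ \<longleftrightarrow> (\<forall>I :: nat \<Rightarrow> 'a set. (\<forall>n. ideal (I n)) \<longrightarrow> (\<forall>n. I n \<subseteq> I (Suc n)) \<longrightarrow>
     (\<exists>N. \<forall>n\<ge>N. I n = I N))"

lemma noetherianD:
  assumes "noetherian TYPE('a::comm_ring_1)" "\<And>n. ideal (I n :: 'a set)" "\<And>n. I n \<subseteq> I (Suc n)"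
  obtains N where "\<And>n. n \<ge> N \<Longrightarrow> I n = I N"
  using assms unfolding noetherian_def by meson

lemma ideal_diff: "ideal I \<Longrightarrow> x \<in> I \<Longrightarrow> y \<in> I \<Longrightarrow> x - y \<in> I"
  unfolding ideal_def by (metis add_uminus_conv_diff mult_minus1)

lemma noetherian_field: "noetherian TYPE('a::field)"
  unfolding noetherian_def
proof (intro allI impI)
  fix I :: "nat \<Rightarrow> 'a set"
  assume I: "\<forall>n. ideal (I n)" and mono: "\<forall>n. I n \<subseteq> I (Suc n)"
  show "\<exists>N. \<forall>n\<ge>N. I n = I N"
  proof (cases "\<exists>N. \<exists>x\<in>I N. x \<noteq> 0")
    case True
    then obtain N x where x: "x \<in> I N" "x \<noteq> 0" by blast
    have "I n = UNIV" if "n \<ge> N" for n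
    proof -
      have "x \<in> I n" using lift_Suc_mono_le[of I N n] mono that x by blast
      then have "(y / x) * x \<in> I n" for y using I unfolding ideal_def by blast
      then show ?thesis using x(2) by auto
    qed
    then show ?thesis by auto
  next
    case False
    then have "I n = {0}" for n using I unfolding ideal_def by blast
    then show ?thesis by auto
  qed
qed

text \<open>The ideals of leading coefficients increase both with \<open>n\<close> and with the
  degree bound. Once they are stationary in \<open>n\<close> for all degrees at once, a member of
  \<open>I n\<close> is moved into \<open>I M\<close> by killing its leading coefficients one after
  the other.\<close>

lemma noetherian_poly:
  assumes "noetherian TYPE('a::comm_ring_1)"
  shows "noetherian TYPE('a poly)"
  unfolding noetherian_def
proof (intro allI impI)
  fix I :: "nat \<Rightarrow> 'a poly set"
  assume I: "\<forall>n. ideal (I n)" and mono: "\<forall>n. I n \<subseteq> I (Suc n)"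
  have I_mono: "I n \<subseteq> I n'" if "n \<le> n'" for n n' using lift_Suc_mono_le[of I] mono that by blast
  \<comment> \<open>Degree at most \<open>d\<close>, not exactly \<open>d\<close>: this includes 0
    and makes \<open>L n d\<close> an ideal.\<close>
  define L where "L n d = {coeff p d | p. p \<in> I n \<and> degree p \<le> d}" for n d
  have L_ideal: "ideal (L n d)" for n d
    unfolding ideal_def
  proof (intro conjI ballI allI)
    show "0 \<in> L n d" using I unfolding L_def ideal_def by (auto intro!: exI[of _ 0])
  next
    fix x y assume "x \<in> L n d" "y \<in> L n d"
    then obtain p q where "x = coeff p d" "p \<in> I n" "degree p \<le> d" "y = coeff q d" "q \<in> I n" "degree q \<le> d"
      unfolding L_def by blast
    then show "x + y \<in> L n d"
      using I unfolding L_def ideal_def by (auto intro!: exI[of _ "p + q"] degree_add_le)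
  next
    fix x r assume "x \<in> L n d"
    then obtain p where p: "x = coeff p d" "p \<in> I n" "degree p \<le> d" unfolding L_def by blast
    have "[:r:] * p \<in> I n" using I p unfolding ideal_def by blast
    then show "r * x \<in> L n d"
      using p unfolding L_def by (auto intro!: exI[of _ "smult r p"] order_trans[OF degree_smult_le])
  qed
  have L1: "L n d \<subseteq> L n' d" if "n \<le> n'" for n n' d using I_mono[OF that] unfolding L_def by blast
  have L2: "L n d \<subseteq> L n (Suc d)" for n d
  proof
    fix x assume "x \<in> L n d"
    then obtain p where p: "x = coeff p d" "p \<in> I n" "degree p \<le> d" unfolding L_def by blast
    have "[:0, 1:] * p \<in> I n" using I p unfolding ideal_def by blast
    then show "x \<in> L n (Suc d)" using p unfolding L_def
      by (auto intro!: exI[of _ "pCons 0 p"] order_trans[OF degree_pCons_le])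
  qed
  then have L2: "L n d \<subseteq> L n d'" if "d \<le> d'" for n d d' using lift_Suc_mono_le[of "L n"] that by blast
  obtain N where N: "\<And>n. n \<ge> N \<Longrightarrow> L n n = L N N"
  proof (rule noetherianD[OF assms, of "\<lambda>n. L n n"])
    show "L n n \<subseteq> L (Suc n) (Suc n)" for n using L1[of n "Suc n" n] L2[of n "Suc n" "Suc n"] by auto
  qed (auto intro: L_ideal)
  \<comment> \<open>The diagonal chain settles all \<open>n\<close> and \<open>d\<close> from
    \<open>N\<close> on; the finitely many \<open>d < N\<close> are treated separately.\<close>
  have big: "L n d = L N N" if "n \<ge> N" "d \<ge> N" for n d
    using N[of "max n d"] that L1[of n "max n d" d] L2[of d "max n d" "max n d"]
      L1[of N n N] L2[of N d n] by auto
  have "\<exists>K. \<forall>n\<ge>K. L n d = L K d" for d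
  proof (rule noetherianD[OF assms, of "\<lambda>n. L n d"])
    show "L n d \<subseteq> L (Suc n) d" for n by (rule L1) simp
  qed (auto intro: L_ideal)
  then obtain K where K: "\<And>n d. n \<ge> K d \<Longrightarrow> L n d = L (K d) d" by metis
  define M where "M = N + (\<Sum>d<N. K d)"
  have "K d \<le> M" if "d < N" for d
    using member_le_sum[of d "{..<N}" K] that by (simp add: M_def)
  then have stable: "L n d = L M d" if "n \<ge> M" for n d
  proof (cases "d < N")
    case True
    then show ?thesis using K[of d n] K[of d M] \<open>d < N \<Longrightarrow> K d \<le> M\<close> that by auto
  next
    case False
    then show ?thesis using big[of n d] big[of M d] that by (simp add: M_def)
  qed
  have "p \<in> I M" if "p \<in> I n" "degree p \<le> d" "n \<ge> M" for p n d
    using that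
  proof (induction d arbitrary: p)
    case (0 p)
    then have "coeff p 0 \<in> L M 0" using stable[of n 0] unfolding L_def by blast
    then obtain q where q: "q \<in> I M" "degree q \<le> 0" "coeff q 0 = coeff p 0" unfolding L_def by auto
    have "p = q" using 0(2) q(2,3) by (metis degree_0_id le_zero_eq)
    then show ?case using q by simp
  next
    case (Suc d p)
    then have "coeff p (Suc d) \<in> L M (Suc d)" using stable[of n "Suc d"] unfolding L_def by blast
    then obtain q where q: "q \<in> I M" "degree q \<le> Suc d" "coeff q (Suc d) = coeff p (Suc d)"
      unfolding L_def by auto
    have "degree (p - q) \<le> d"
    proof (rule degree_le, intro allI impI)
      fix i assume "d < i"
      then show "coeff (p - q) i = 0"
        using Suc.prems(2) q by (cases "i = Suc d") (auto simp: coeff_eq_0)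
    qed
    moreover have "p - q \<in> I n" using I Suc.prems q(1) I_mono[of M n] by (auto intro: ideal_diff)
    ultimately have "p - q \<in> I M" using Suc.IH Suc.prems(3) by blast
    then have "(p - q) + q \<in> I M" using I q(1) unfolding ideal_def by blast
    then show ?case by simp
  qed
  then show "\<exists>N. \<forall>n\<ge>N. I n = I N" using I_mono by blast
qed

section \<open>Points of projective space\<close>

definition rep :: "proj3 \<Rightarrow> complex ^ 4" where
  "rep P = (SOME v. v \<in> coords P)"

lemma line_of_span: "\<exists>v. v \<noteq> 0 \<and> line_of P = range (\<lambda>k. k *s v)"
  using line_of[of P] by (auto simp: vec.span_singleton)

lemma coords_nonempty: "\<exists>v. v \<in> coords P"
proof -
  obtain v where v: "v \<noteq> 0" "line_of P = range (\<lambda>k. k *s v)" using line_of_span by blast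
  then have "1 *s v \<in> line_of P" by blast
  then show ?thesis using v by (auto simp: coords_def)
qed

lemma rep_coords: "rep P \<in> coords P"
  unfolding rep_def using coords_nonempty by (rule someI_ex)

lemma rep_nonzero [simp]: "rep P \<noteq> 0"
  using rep_coords[of P] by (simp add: coords_def)

lemma line_of_rep: "line_of P = range (\<lambda>k. k *s rep P)"
proof -
  obtain v where v: "v \<noteq> 0" "line_of P = range (\<lambda>k. k *s v)" using line_of_span by blast
  obtain c where c: "rep P = c *s v" using rep_coords[of P] v by (auto simp: coords_def)
  then have "c \<noteq> 0" using rep_nonzero[of P] by auto
  have "k *s v = (k / c) *s rep P" for k using \<open>c \<noteq> 0\<close> by (simp add: c)
  moreover have "k *s rep P = (k * c) *s v" for k by (simp add: c)
  ultimately show ?thesis unfolding v(2) by (metis (no_types, lifting) image_subset_iff rangeI subset_antisym)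
qed

lemma coords_rep: "coords P = {k *s rep P | k. k \<noteq> 0}"
  by (auto simp: coords_def line_of_rep)

lemma rep_inj:
  assumes "rep P = k *s rep Q"
  shows "P = Q"
proof -
  have k: "k \<noteq> 0" using assms rep_nonzero[of P] by auto
  have "c *s rep Q = (c / k) *s rep P" for c using k by (simp add: assms)
  moreover have "c *s rep P = (c * k) *s rep Q" for c by (simp add: assms)
  ultimately have "line_of P = line_of Q"
    unfolding line_of_rep by (metis (no_types, lifting) image_subset_iff rangeI subset_antisym)
  then show ?thesis by (simp add: line_of_inject)
qed

lemma proj3_exists:
  assumes "v \<noteq> 0"
  obtains P k where "k \<noteq> 0" "v = k *s rep P"
proof -
  have "line_of (Abs_proj3 (vec.span {v})) = vec.span {v}"
    using assms by (intro Abs_proj3_inverse) blast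
  then have "v \<in> coords (Abs_proj3 (vec.span {v}))"
    using assms by (simp add: coords_def vec.span_base)
  then show thesis using that by (auto simp: coords_rep)
qed

lemma vanishes_at_rep:
  assumes "p \<in> forms d"
  shows "vanishes_at p P \<longleftrightarrow> eval_poly p (rep P) = 0"
proof
  assume "vanishes_at p P"
  then show "eval_poly p (rep P) = 0" using rep_coords by (auto simp: vanishes_at_def)
qed (auto simp: vanishes_at_def coords_rep eval_form_scale[OF assms])

lemma separating_linear_form:
  assumes "P \<noteq> Q"
  obtains p where "p \<in> forms 1" "eval_poly p (rep P) = 0" "eval_poly p (rep Q) \<noteq> 0"
proof -
  obtain i where i: "rep P $ i \<noteq> 0" by (metis rep_nonzero vec_eq_iff zero_index)
  \<comment> \<open>These are 2x2 minors through the nonzero coordinate \<open>i\<close>; they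
    vanish together only at multiples of \<open>rep P\<close>.\<close>
  define p where "p j = Cst (rep P $ i) * Var j - Cst (rep P $ j) * Var i" for j
  have "p j \<in> forms 1" for j
    unfolding p_def forms_eq_hf One_nat_def by (intro hf_diff hf_Cst_mult Var_hf)
  moreover have "eval_poly (p j) (rep P) = 0" for j by (simp add: p_def)
  moreover have "\<exists>j. eval_poly (p j) (rep Q) \<noteq> 0"
  proof (rule ccontr)
    assume "\<nexists>j. eval_poly (p j) (rep Q) \<noteq> 0"
    then have "rep P $ i * rep Q $ j = rep P $ j * rep Q $ i" for j by (simp add: p_def)
    then have "rep Q = (rep Q $ i / rep P $ i) *s rep P"
      using i by (simp add: vec_eq_iff field_simps)
    then show False using rep_inj assms by metis
  qed
  ultimately show thesis using that by blast
qed

lemma separating_form: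
  assumes "finite Y" "Q \<notin> Y"
  obtains p where "p \<in> forms (card Y)" "\<forall>P\<in>Y. eval_poly p (rep P) = 0" "eval_poly p (rep Q) \<noteq> 0"
proof -
  have "\<exists>p\<in>forms (card Y). (\<forall>P\<in>Y. eval_poly p (rep P) = 0) \<and> eval_poly p (rep Q) \<noteq> 0"
    using assms
  proof (induction Y rule: finite_induct)
    case empty
    then show ?case by (intro bexI[of _ 1]) (auto simp: forms_eq_hf hf_one)
  next
    case (insert P Y)
    then obtain p where p: "p \<in> forms (card Y)" "\<forall>P\<in>Y. eval_poly p (rep P) = 0" "eval_poly p (rep Q) \<noteq> 0"
      by auto
    have "P \<noteq> Q" using insert by auto
    then obtain q where q: "q \<in> forms 1" "eval_poly q (rep P) = 0" "eval_poly q (rep Q) \<noteq> 0"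
      by (rule separating_linear_form)
    have "q * p \<in> forms (card (insert P Y))" using forms_mult[OF q(1) p(1)] insert by simp
    then show ?case using p q by (intro bexI[of _ "q * p"]) auto
  qed
  then obtain p where "p \<in> forms (card Y)" "\<forall>P\<in>Y. eval_poly p (rep P) = 0" "eval_poly p (rep Q) \<noteq> 0"
    by (elim bexE conjE)
  then show thesis using that[of p] by blast
qed

section \<open>Infinite closed sets contain curves\<close>

lemma finite_zariski_closed:
  assumes "finite Y"
  shows "zariski_closed Y"
  unfolding zariski_closed_def
proof (intro exI conjI)
  show "{p \<in> \<Union>d. forms d. \<forall>P\<in>Y. vanishes_at p P} \<subseteq> (\<Union>d. forms d)" by blast
  show "Y = zero_locus {p \<in> \<Union>d. forms d. \<forall>P\<in>Y. vanishes_at p P}"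
  proof (intro equalityI subsetI)
    fix Q assume Q: "Q \<in> zero_locus {p \<in> \<Union>d. forms d. \<forall>P\<in>Y. vanishes_at p P}"
    show "Q \<in> Y"
    proof (rule ccontr)
      assume "Q \<notin> Y"
      with assms obtain p where "p \<in> forms (card Y)" "\<forall>P\<in>Y. eval_poly p (rep P) = 0"
        "eval_poly p (rep Q) \<noteq> 0"
        by (rule separating_form)
      then show False using Q by (auto simp: zero_locus_def vanishes_at_rep)
    qed
  qed (auto simp: zero_locus_def)
qed

text \<open>Iterated univariate polynomials form a ring to which \<open>noetherian_poly\<close>
  applies; the arguments are embedded as constants of the intermediate rings.\<close>

abbreviation nested_eval :: "complex poly poly poly poly \<Rightarrow> complex ^ 4 \<Rightarrow> complex" where
  "nested_eval q v \<equiv> poly (poly (poly (poly q [:[:[:v $ 1:]:]:]) [:[:v $ 2:]:]) [:v $ 3:]) (v $ 4)"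

lemma form_nested:
  assumes "p \<in> forms d"
  shows "\<exists>q. \<forall>v. nested_eval q v = eval_poly p v"
  using assms[unfolded forms_eq_hf]
proof (induction rule: hf_induct)
  case (zero d)
  show ?case by (intro exI[of _ 0]) auto
next
  case (const c)
  show ?case by (intro exI[of _ "[:[:[:[:c:]:]:]:]"]) auto
next
  case (add d p q)
  then obtain p' q' where "\<forall>v. nested_eval p' v = eval_poly p v" "\<forall>v. nested_eval q' v = eval_poly q v" by blast
  then show ?case by (intro exI[of _ "p' + q'"]) auto
next
  case (gen x d p)
  then obtain i q where x: "x = Var i" and q: "\<forall>v. nested_eval q v = eval_poly p v" by blast
  have "\<exists>r. \<forall>v. nested_eval r v = v $ i"
  proof -
    have "nested_eval [:0, 1:] v = v $ 1" "nested_eval [:[:0, 1:]:] v = v $ 2"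
      "nested_eval [:[:[:0, 1:]:]:] v = v $ 3" "nested_eval [:[:[:[:0, 1:]:]:]:] v = v $ 4" for v
      by simp_all
    then show ?thesis using exhaust_4[of i] by metis
  qed
  then obtain r where "\<forall>v. nested_eval r v = v $ i" by blast
  then show ?case using q x by (intro exI[of _ "r * q"]) auto
qed

text \<open>The ideals of nested polynomials vanishing on the cones over \<open>Z n\<close>
  increase, and \<open>Z n\<close> is recovered from its ideal because its defining forms are among
  these polynomials.\<close>

lemma zariski_closed_chain_stabilizes:
  assumes closed: "\<And>n. zariski_closed (Z n)" and decr: "\<And>n. Z (Suc n) \<subseteq> Z n"
  obtains N where "\<And>n. n \<ge> N \<Longrightarrow> Z n = Z N"
proof -
  define I where "I n = {q. \<forall>P\<in>Z n. \<forall>v\<in>coords P. nested_eval q v = 0}" for n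
  have "noetherian TYPE(complex poly poly poly poly)"
    by (intro noetherian_poly noetherian_field)
  then obtain N where N: "\<And>n. n \<ge> N \<Longrightarrow> I n = I N"
  proof (rule noetherianD[of I])
    show "ideal (I n)" for n by (auto simp: ideal_def I_def)
    show "I n \<subseteq> I (Suc n)" for n using decr[of n] by (auto simp: I_def)
  qed auto
  have "Z n = Z N" if n: "n \<ge> N" for n
  proof
    show "Z n \<subseteq> Z N" using lift_Suc_antimono_le[of Z] decr n by blast
    obtain S where S: "S \<subseteq> (\<Union>d. forms d)" "Z n = zero_locus S"
      using closed[of n] by (auto simp: zariski_closed_def)
    show "Z N \<subseteq> Z n"
    proof
      fix P assume P: "P \<in> Z N"
      have "vanishes_at p P" if p: "p \<in> S" for p
      proof -
        obtain d where "p \<in> forms d" using S p by blast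
        then obtain q where q: "\<And>v. nested_eval q v = eval_poly p v" using form_nested by metis
        have "q \<in> I n" using p unfolding I_def S(2) by (auto simp: q zero_locus_def vanishes_at_def)
        then have "q \<in> I N" unfolding N[OF n] .
        then show ?thesis using P by (auto simp: I_def q vanishes_at_def)
      qed
      then show "P \<in> Z n" by (auto simp: S zero_locus_def)
    qed
  qed
  then show thesis using that by blast
qed

text \<open>Noetherian induction: otherwise dependent choice yields a strictly decreasing sequence
  of infinite closed sets.\<close>

lemma minimal_infinite_closed:
  assumes "zariski_closed X" "infinite X"
  obtains C where "zariski_closed C" "infinite C" "C \<subseteq> X"
    "\<And>Z. zariski_closed Z \<Longrightarrow> Z \<subset> C \<Longrightarrow> finite Z"
proof -
  define Q where "Q C \<longleftrightarrow> zariski_closed C \<and> infinite C \<and> C \<subseteq> X" for C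
  have "\<exists>C. Q C \<and> (\<forall>Z. Q Z \<longrightarrow> \<not> Z \<subset> C)"
  proof (rule ccontr)
    assume "\<not> (\<exists>C. Q C \<and> (\<forall>Z. Q Z \<longrightarrow> \<not> Z \<subset> C))"
    then have smaller: "\<And>C. Q C \<Longrightarrow> \<exists>Z. Q Z \<and> Z \<subset> C" by blast
    have "\<exists>Z. \<forall>n::nat. Q (Z n) \<and> Z (Suc n) \<subset> Z n"
    proof (rule dependent_nat_choice)
      show "\<exists>C. Q C" using assms by (auto simp: Q_def)
      show "\<exists>C'. Q C' \<and> C' \<subset> C" if "Q C" for C using that by (rule smaller)
    qed
    then obtain Z where "\<forall>n::nat. Q (Z n) \<and> Z (Suc n) \<subset> Z n" by (rule exE)
    then have Z: "Q (Z n)" "Z (Suc n) \<subset> Z n" for n by simp_all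
    obtain N where N: "\<And>n. n \<ge> N \<Longrightarrow> Z n = Z N"
    proof (rule zariski_closed_chain_stabilizes[of Z])
      show "zariski_closed (Z n)" for n using Z(1) by (simp add: Q_def)
      show "Z (Suc n) \<subseteq> Z n" for n using Z(2) by (rule psubset_imp_subset)
    qed blast
    have "Z (Suc N) = Z N" by (rule N) simp
    then show False using Z(2)[of N] by blast
  qed
  then obtain C where "Q C \<and> (\<forall>Z. Q Z \<longrightarrow> \<not> Z \<subset> C)" by (rule exE)
  then have C: "Q C" "Q Z \<Longrightarrow> \<not> Z \<subset> C" for Z by simp_all
  show thesis
  proof (rule that)
    show "finite Z" if "zariski_closed Z" "Z \<subset> C" for Z
    proof -
      have "Z \<subseteq> X" using that(2) C(1) by (auto simp: Q_def)
      then show ?thesis using C(2)[of Z] that by (auto simp: Q_def)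
    qed
  qed (use C(1) in \<open>auto simp: Q_def\<close>)
qed

lemma irreducible_singleton: "irreducible_closed {P}"
  unfolding irreducible_closed_def
proof (intro conjI allI impI)
  fix Z1 Z2 assume "zariski_closed Z1 \<and> zariski_closed Z2 \<and> {P} = Z1 \<union> Z2"
  then have "Z1 \<subseteq> {P}" "Z2 \<subseteq> {P}" "P \<in> Z1 \<or> P \<in> Z2" by blast+
  then show "{P} = Z1 \<or> {P} = Z2" by blast
qed (simp_all add: finite_zariski_closed)

lemma finite_irreducible:
  assumes "irreducible_closed Z" "finite Z"
  obtains P where "Z = {P}"
proof -
  obtain P where P: "P \<in> Z" using assms by (auto simp: irreducible_closed_def)
  have "zariski_closed {P}" "zariski_closed (Z - {P})" "Z = {P} \<union> (Z - {P})"
    using P assms by (auto intro: finite_zariski_closed)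
  then have "Z = {P} \<or> Z = Z - {P}" using assms(1) unfolding irreducible_closed_def by blast
  then show thesis using that P by blast
qed

text \<open>A minimal infinite closed subset is irreducible, and its proper irreducible closed
  subsets are points, so that no dimension theory is needed.\<close>

lemma infinite_closed_contains_curve:
  assumes "zariski_closed X" "infinite X"
  obtains C where "irreducible_curve C" "C \<subseteq> X"
proof -
  obtain C where C: "zariski_closed C" "infinite C" "C \<subseteq> X"
    and min: "\<And>Z. zariski_closed Z \<Longrightarrow> Z \<subset> C \<Longrightarrow> finite Z"
    using minimal_infinite_closed[OF assms] by metis
  have irr: "irreducible_closed C"
    unfolding irreducible_closed_def
  proof (intro conjI allI impI)
    show "C \<noteq> {}" using C by auto
    fix Z1 Z2 assume Z: "zariski_closed Z1 \<and> zariski_closed Z2 \<and> C = Z1 \<union> Z2"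
    then show "C = Z1 \<or> C = Z2" using min[of Z1] min[of Z2] C(2) by blast
  qed (fact C(1))
  let ?chain = "\<lambda>n D. (\<forall>i\<le>n. irreducible_closed (D i) \<and> D i \<subseteq> C) \<and> (\<forall>i<n. D i \<subset> D (Suc i))"
  have upper: "n \<le> 1" if D: "?chain n D" for n and D :: "nat \<Rightarrow> proj3 set"
  proof (rule ccontr)
    assume "\<not> n \<le> 1"
    then have n: "2 \<le> n" by simp
    have "D 0 \<subset> D 1" "D 1 \<subset> D 2" "D 2 \<subseteq> C" "irreducible_closed (D 1)" "irreducible_closed (D 0)"
      using D n by (auto simp: numeral_2_eq_2)
    \<comment> \<open>A proper closed subset of \<open>C\<close> is finite, so \<open>D 1\<close> is
      a point and nothing irreducible fits strictly below it.\<close>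
    moreover from this have "finite (D 1)" using min[of "D 1"] by (auto simp: irreducible_closed_def)
    ultimately obtain P where "D 1 = {P}" using finite_irreducible by blast
    then have "D 0 = {}" using \<open>D 0 \<subset> D 1\<close> by (auto simp: psubset_eq subset_singleton_iff)
    then show False using \<open>irreducible_closed (D 0)\<close> by (simp add: irreducible_closed_def)
  qed
  obtain P where P: "P \<in> C" using C(2) by (metis finite.emptyI ex_in_conv)
  have "C \<noteq> {P}" using C(2) by auto
  then have "?chain 1 (\<lambda>i. if i = 0 then {P} else C)"
    using P irr irreducible_singleton by auto
  then have "\<exists>D. ?chain 1 D" by (rule exI[of "?chain 1"])
  then have "enat 1 \<in> {enat n | n. \<exists>D. ?chain n D}"
    by (intro CollectI exI[of _ "1::nat"] conjI refl)
  then have "1 \<le> zariski_dim C" unfolding zariski_dim_def one_enat_def by (rule Sup_upper)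
  moreover have "zariski_dim C \<le> 1" unfolding zariski_dim_def one_enat_def
    by (rule Sup_least) (use upper in auto)
  ultimately have "irreducible_curve C" using irr by (auto simp: irreducible_curve_def)
  then show thesis using that C(3) by blast
qed

section \<open>Spans of powers of linear forms\<close>

lemma Cst_power: "Cst c ^ n = Cst (c ^ n)"
  by (induction n) (auto simp: mult_single)

text \<open>Rescaling coordinates by \<open>k\<close> multiplies the power by \<open>k ^ d\<close>,
  so one representative per point is enough.\<close>

lemma span_veronese:
  assumes "finite A" "F \<in> poly4.span (veronese d A)"
  obtains a where "F = (\<Sum>P\<in>A. Cst (a P) * linear_form (rep P) ^ d)"
proof -
  define T where "T = range (\<lambda>a. \<Sum>P\<in>A. Cst (a P) * linear_form (rep P) ^ d)"
  have "veronese d A \<subseteq> T"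
  proof
    fix p assume "p \<in> veronese d A"
    then obtain P k where P: "P \<in> A" "p = linear_form (k *s rep P) ^ d"
      by (auto simp: veronese_def coords_rep)
    have "(\<Sum>Q\<in>A. Cst (if Q = P then k ^ d else 0) * linear_form (rep Q) ^ d)
      = (\<Sum>Q\<in>A. if Q = P then Cst (k ^ d) * linear_form (rep Q) ^ d else 0)"
      by (intro sum.cong) auto
    also have "\<dots> = p" using P assms(1) by (simp add: linear_form_scale power_mult_distrib Cst_power)
    finally show "p \<in> T" unfolding T_def
      by (intro range_eqI[of _ _ "\<lambda>Q. if Q = P then k ^ d else 0"]) (rule sym)
  qed
  moreover have "poly4.subspace T"
    unfolding poly4.subspace_def
  proof (intro conjI ballI allI)
    show "0 \<in> T" unfolding T_def by (intro range_eqI[of _ _ "\<lambda>_. 0"]) simp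
  next
    fix p q assume "p \<in> T" "q \<in> T"
    then obtain a b where "p = (\<Sum>P\<in>A. Cst (a P) * linear_form (rep P) ^ d)"
      "q = (\<Sum>P\<in>A. Cst (b P) * linear_form (rep P) ^ d)" unfolding T_def by blast
    then have "p + q = (\<Sum>P\<in>A. Cst (a P + b P) * linear_form (rep P) ^ d)"
      by (simp add: single_add distrib_right sum.distrib)
    then show "p + q \<in> T" unfolding T_def by (intro range_eqI[of _ _ "\<lambda>P. a P + b P"])
  next
    fix c p assume "p \<in> T"
    then obtain a where "p = (\<Sum>P\<in>A. Cst (a P) * linear_form (rep P) ^ d)" unfolding T_def by blast
    then have "pscale c p = (\<Sum>P\<in>A. Cst (c * a P) * linear_form (rep P) ^ d)"
      by (simp add: pscale_eq sum_distrib_left mult_single flip: mult.assoc)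
    then show "pscale c p \<in> T" unfolding T_def by (intro range_eqI[of _ _ "\<lambda>P. c * a P"])
  qed
  ultimately have "F \<in> T" using assms(2) poly4.span_minimal by blast
  then show thesis using that unfolding T_def by blast
qed

lemma power_in_span_veronese:
  "P \<in> A \<Longrightarrow> Cst c * linear_form (rep P) ^ d \<in> poly4.span (veronese d A)"
  unfolding pscale_eq[symmetric]
  by (intro poly4.span_scale poly4.span_base) (auto simp: veronese_def intro: rep_coords)

text \<open>A point with coefficient 0 could be dropped from the decomposition.\<close>

lemma nonredundant_coefficients:
  assumes "nonredundant_decomposition d F A"
  obtains a where "F = (\<Sum>P\<in>A. Cst (a P) * linear_form (rep P) ^ d)" "\<forall>P\<in>A. a P \<noteq> 0"
proof -
  have A: "finite A" "F \<in> poly4.span (veronese d A)"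
    using assms by (auto simp: nonredundant_decomposition_def decomposition_def)
  then obtain a where a: "F = (\<Sum>P\<in>A. Cst (a P) * linear_form (rep P) ^ d)"
    by (rule span_veronese)
  have "a P \<noteq> 0" if P: "P \<in> A" for P
  proof
    assume "a P = 0"
    then have "F = (\<Sum>Q\<in>A - {P}. Cst (a Q) * linear_form (rep Q) ^ d)"
      using a A(1) P by (simp add: sum.remove)
    moreover have "(\<Sum>Q\<in>A - {P}. Cst (a Q) * linear_form (rep Q) ^ d)
        \<in> poly4.span (veronese d (A - {P}))"
      by (intro poly4.span_sum power_in_span_veronese)
    ultimately have "F \<in> poly4.span (veronese d (A - {P}))" by simp
    moreover have "A - {P} \<subset> A" using P by blast
    ultimately show False using assms by (auto simp: nonredundant_decomposition_def)
  qed
  then show thesis using that a by blast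
qed

section \<open>Relations between values of sextics\<close>

lemma forms_sum: "(\<And>k. k \<in> K \<Longrightarrow> f k \<in> forms d) \<Longrightarrow> sum f K \<in> forms d"
  by (simp add: forms_eq_hf hf_sum)

text \<open>The bilinear form \<open>\<lambda>p q. \<Sum>z. c z * p z * q z\<close> on cubics vanishes identically; the cubics \<open>q a\<close>
  make it nondegenerate on \<open>A\<close>, so they already account for all values on \<open>B\<close>.\<close>

lemma cubics_vanish_on_residual:
  assumes fin: "finite A" "finite B" and disj: "A \<inter> B = {}" and card: "card B \<le> card A"
    and c: "\<And>P. P \<in> A \<Longrightarrow> c P \<noteq> 0"
    and rel: "\<And>G. G \<in> forms 6 \<Longrightarrow> (\<Sum>P\<in>A \<union> B. c P * eval_poly G (rep P)) = 0"
    and q: "\<And>P. P \<in> A \<Longrightarrow> q P \<in> forms 3" "\<And>P. P \<in> A \<Longrightarrow> eval_poly (q P) (rep P) \<noteq> 0"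
      "\<And>P Q. P \<in> A \<Longrightarrow> Q \<in> A \<Longrightarrow> P \<noteq> Q \<Longrightarrow> eval_poly (q P) (rep Q) = 0"
    and w: "w \<in> forms 3" "\<And>P. P \<in> A \<Longrightarrow> eval_poly w (rep P) = 0"
    and Q: "Q \<in> B"
  shows "eval_poly w (rep Q) = 0"
proof -
  \<comment> \<open>One unknown for \<open>w\<close> (\<open>None\<close>) and one for each
    \<open>q P\<close>: more unknowns than conditions imposed by the points of
    \<open>B\<close>.\<close>
  define K where "K = insert None (Some ` A)"
  define M where "M i R = eval_poly (case i of None \<Rightarrow> w | Some P \<Rightarrow> q P) (rep R)" for i R
  have "card K = Suc (card A)" using fin by (simp add: K_def card_image)
  then have "card B < card K" using card by simp
  then obtain x where x: "\<exists>i\<in>K. x i \<noteq> 0" "\<forall>R\<in>B. (\<Sum>i\<in>K. x i * M i R) = 0"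
    using underdetermined_system[of B K M] fin by (auto simp: K_def)
  define p where "p = Cst (x None) * w + (\<Sum>P\<in>A. Cst (x (Some P)) * q P)"
  have p: "p \<in> forms 3"
    unfolding p_def using q w by (intro forms_add forms_sum forms_Cst_mult) auto
  have "(\<Sum>i\<in>K. x i * M i R) = eval_poly p (rep R)" for R
    using fin by (simp add: K_def p_def M_def sum.reindex)
  then have pB: "eval_poly p (rep R) = 0" if "R \<in> B" for R using x(2) that by metis
  have pA: "eval_poly p (rep P) = x (Some P) * eval_poly (q P) (rep P)" if P: "P \<in> A" for P
  proof -
    have "(\<Sum>P'\<in>A. x (Some P') * eval_poly (q P') (rep P))
        = (\<Sum>P'\<in>A. if P' = P then x (Some P) * eval_poly (q P) (rep P) else 0)"
      using q(3) P by (intro sum.cong) auto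
    then show ?thesis using P fin by (simp add: p_def w(2))
  qed
  \<comment> \<open>Testing against \<open>q P * p\<close> isolates the point \<open>P\<close>:
    \<open>q P\<close> vanishes on the rest of \<open>A\<close>, and \<open>p\<close> vanishes on
    \<open>B\<close>.\<close>
  have x0: "x (Some P) = 0" if P: "P \<in> A" for P
  proof -
    have "q P * p \<in> forms 6" using forms_mult[OF q(1)[OF P] p] by simp
    then have "0 = (\<Sum>R\<in>A \<union> B. c R * eval_poly (q P * p) (rep R))" by (simp only: rel)
    also have "\<dots> = (\<Sum>R\<in>A \<union> B. if R = P then c P * eval_poly (q P * p) (rep P) else 0)"
      using q(3) P pB by (intro sum.cong) auto
    also have "\<dots> = c P * eval_poly (q P) (rep P) * (x (Some P) * eval_poly (q P) (rep P))"
      using P fin by (simp add: pA)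
    finally show ?thesis using c[OF P] q(2)[OF P] by simp
  qed
  \<comment> \<open>What remains of \<open>p\<close> is a nonzero multiple of
    \<open>w\<close>.\<close>
  then have "x None \<noteq> 0" using x(1) by (auto simp: K_def)
  moreover have "x None * eval_poly w (rep Q) = 0"
    using pB[OF Q] x0 by (simp add: p_def)
  ultimately show ?thesis by simp
qed

text \<open>In effect \<open>Z\<close> imposes independent conditions on sextics: the final
  \<open>G\<close> is a sextic that vanishes on \<open>Z\<close> except at \<open>Q\<close>.\<close>

lemma no_relation_on_finite_base_locus:
  assumes W: "W \<subseteq> forms 3" "0 \<in> W" "\<And>p q. p \<in> W \<Longrightarrow> q \<in> W \<Longrightarrow> p + q \<in> W"
      "\<And>a p. p \<in> W \<Longrightarrow> Cst a * p \<in> W"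
    and base: "finite (zero_locus W)" and Z: "Z \<subseteq> zero_locus W"
    and rel: "\<And>G. G \<in> forms 6 \<Longrightarrow> (\<Sum>P\<in>Z. c P * eval_poly G (rep P)) = 0"
    and Q: "Q \<in> Z"
  shows "c Q = 0"
proof -
  have locus: "P \<in> zero_locus W \<longleftrightarrow> (\<forall>w\<in>W. eval_poly w (rep P) = 0)" for P
    using W(1) vanishes_at_rep[of _ 3] by (simp add: zero_locus_def subset_iff)
  have finZ: "finite Z" using base Z by (rule rev_finite_subset)
  \<comment> \<open>Requiring \<open>l\<close> to be nonzero at this vector makes its coefficient at
    \<open>Var 1\<close> nonzero, so that \<open>Var 1\<close> can be expressed by \<open>l\<close>
    and the other coordinates.\<close>
  let ?e = "axis 1 1 :: complex ^ 4"
  have "\<exists>l\<in>forms 1. \<forall>v\<in>insert ?e (rep ` zero_locus W). eval_poly l v \<noteq> 0"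
  proof (rule avoid_finitely_many_points)
    fix v assume "v \<in> insert ?e (rep ` zero_locus W)"
    then have "v \<noteq> 0" by (auto simp: axis_eq_0_iff)
    then obtain i where "v $ i \<noteq> 0" by (metis vec_eq_iff zero_index)
    then show "\<exists>w\<in>forms 1. eval_poly w v \<noteq> 0"
      using Var_hf[of i] by (intro bexI[of _ "Var i"]) (auto simp: forms_eq_hf)
  qed (use base in \<open>auto simp: forms_eq_hf intro: hf_zero hf_add hf_Cst_mult\<close>)
  then obtain l where l: "l \<in> forms 1" "eval_poly l ?e \<noteq> 0"
    "\<And>P. P \<in> zero_locus W \<Longrightarrow> eval_poly l (rep P) \<noteq> 0" by auto
  obtain u where u: "l = linear_form u" using l(1) forms_one_range by auto
  have "eval_poly l ?e = u $ 1"
    by (simp add: u eval_linear_form axis_def if_distrib cong: if_cong)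
  then have u1: "u $ 1 \<noteq> 0" using l(2) by simp
  let ?R = "insert l {Var 2, Var 3, Var 4}"
  have Var1: "Cst (u $ 1) * Var 1 = l - Cst (u $ 2) * Var 2 - Cst (u $ 3) * Var 3 - Cst (u $ 4) * Var 4"
    unfolding u linear_form_eq sum_4 by (simp only: algebra_simps)
  have "Cst (1 / u $ 1) * (Cst (u $ 1) * Var 1) \<in> hf ?R (Suc 0)"
    unfolding Var1 by (intro hf_Cst_mult hf_diff hf_generator) simp_all
  then have "Var 1 \<in> hf ?R (Suc 0)" using u1 by (simp add: mult_single flip: mult.assoc)
  then have "Var i \<in> hf ?R (Suc 0)" for i
    using exhaust_4[of i] hf_generator[of "Var i" ?R] by auto
  then have "range Var \<subseteq> hf ?R (Suc 0)" by blast
  then have forms_R: "p \<in> hf ?R d" if "p \<in> forms d" for p d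
    using that hf_generators unfolding forms_eq_hf by blast
  have R_forms: "p \<in> forms d" if "p \<in> hf ?R d" for p d
    using that unfolding forms_eq_hf
    by (rule hf_generators[rotated]) (use l(1) Var_hf in \<open>auto simp: forms_eq_hf\<close>)
  have tern_forms: "p \<in> forms d" if "p \<in> tern d" for p d
    using that by (intro R_forms hf_mono[OF _ that]) auto
  have split: "\<exists>p0\<in>tern (Suc d). \<exists>p1\<in>forms d. p = p0 + l * p1" if "p \<in> forms (Suc d)" for p d
    using hf_insert_split[OF forms_R[OF that]] R_forms by metis
  \<comment> \<open>Restrictions of \<open>W\<close> to the plane \<open>l = 0\<close>, realised as
    remainders modulo \<open>l\<close>.\<close>
  define V where "V = {w0 \<in> tern 3. \<exists>w1\<in>forms 2. w0 + l * w1 \<in> W}"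
  interpret ternary_cubics V
  proof
    show "0 \<in> V" using W(2) by (auto simp: V_def forms_eq_hf intro!: hf_zero bexI[of _ 0])
  next
    fix p q assume "p \<in> V" "q \<in> V"
    then obtain p1 q1 where pq: "p \<in> tern 3" "q \<in> tern 3" "p1 \<in> forms 2" "q1 \<in> forms 2"
      "p + l * p1 \<in> W" "q + l * q1 \<in> W" by (auto simp: V_def)
    have "(p + q) + l * (p1 + q1) = (p + l * p1) + (q + l * q1)" by (simp add: algebra_simps)
    then have "(p + q) + l * (p1 + q1) \<in> W" using W(3)[OF pq(5,6)] by (simp only:)
    then show "p + q \<in> V"
      using hf_add[OF pq(1,2)] forms_add[OF pq(3,4)] unfolding V_def by blast
  next
    fix p a assume "p \<in> V"
    then obtain p1 where "p \<in> tern 3" "p1 \<in> forms 2" "p + l * p1 \<in> W" by (auto simp: V_def)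
    moreover have "Cst a * p + l * (Cst a * p1) = Cst a * (p + l * p1)" by (simp add: algebra_simps)
    ultimately show "Cst a * p \<in> V"
      using W(4) unfolding V_def by (auto intro!: hf_Cst_mult bexI[of _ "Cst a * p1"] forms_Cst_mult)
  next
    fix m y x :: complex assume nz: "(m, y, x) \<noteq> (0, 0, 0)"
    \<comment> \<open>The point of the plane \<open>l = 0\<close> with remaining coordinates
      \<open>m\<close>, \<open>y\<close>, \<open>x\<close>; the first one is solved from
      \<open>l\<close>.\<close>
    define v :: "complex ^ 4" where "v = (\<chi> i. if i = 1 then - (u $ 2 * m + u $ 3 * y + u $ 4 * x) / u $ 1 else pt m y x $ i)"
    have v: "v $ 1 = - (u $ 2 * m + u $ 3 * y + u $ 4 * x) / u $ 1" "v $ 2 = m" "v $ 3 = y" "v $ 4 = x"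
      by (simp_all add: v_def)
    have lv: "eval_poly l v = 0" using u1 by (simp add: u eval_linear_form sum_4 v)
    have "v \<noteq> 0" using nz v by auto
    then obtain P k where P: "k \<noteq> 0" "v = k *s rep P" by (rule proj3_exists)
    have "eval_poly l (rep P) = 0" using lv P eval_form_scale[OF l(1), of k "rep P"] by simp
    then have "P \<notin> zero_locus W" using l(3) by blast
    then obtain w where w: "w \<in> W" "eval_poly w (rep P) \<noteq> 0" using locus by blast
    then have wv: "eval_poly w v \<noteq> 0" using W(1) P eval_form_scale[of w 3 k "rep P"] by auto
    obtain w0 w1 where w0: "w0 \<in> tern 3" "w1 \<in> forms 2" "w = w0 + l * w1"
      using split[of w 2] W(1) w(1) by auto
    have "eval_poly w0 (pt m y x) = eval_poly w0 v" by (rule eval_tern_cong[OF w0(1)]) (simp_all add: v)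
    then have "eval_poly w0 (pt m y x) \<noteq> 0" using wv w0(3) lv by simp
    moreover have "w0 \<in> V" using w0 w(1) by (auto simp: V_def)
    ultimately show "\<exists>w\<in>V. eval_poly w (pt m y x) \<noteq> 0" by blast
  qed (simp add: V_def)
  have ideal_on_Z: "\<exists>G\<in>forms (n - 1). \<forall>P\<in>Z. eval_poly p (rep P) = eval_poly l (rep P) * eval_poly G (rep P)"
    if "gideal cubics n p" for n p
    using that
  proof (induction rule: gideal.induct)
    case (zero n)
    show ?case by (intro bexI[of _ 0]) (auto simp: forms_eq_hf hf_zero)
  next
    case (add n p p')
    then obtain G G' where "G \<in> forms (n - 1)" "G' \<in> forms (n - 1)"
      "\<forall>P\<in>Z. eval_poly p (rep P) = eval_poly l (rep P) * eval_poly G (rep P)"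
      "\<forall>P\<in>Z. eval_poly p' (rep P) = eval_poly l (rep P) * eval_poly G' (rep P)" by blast
    then show ?case by (intro bexI[of _ "G + G'"] forms_add) (auto simp: distrib_left)
  next
    case (gen e w0 a k n)
    then obtain w1 where w1: "w1 \<in> forms 2" "w0 + l * w1 \<in> W" and e: "e = 3" by (auto simp: V_def)
    \<comment> \<open>\<open>w0 + l * w1\<close> vanishes on \<open>Z\<close>, so there
      \<open>w0\<close> may be replaced by \<open>- l * w1\<close>.\<close>
    have "eval_poly (w0 + l * w1) (rep P) = 0" if "P \<in> Z" for P
      using Z that w1(2) locus by blast
    then have "eval_poly w0 (rep P) = - (eval_poly l (rep P) * eval_poly w1 (rep P))" if "P \<in> Z" for P
      using that by (simp add: eq_neg_iff_add_eq_0)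
    moreover have "Cst (-1) * (w1 * a) \<in> forms (n - 1)"
      using forms_mult[OF w1(1) tern_forms[OF gen(2)]] gen(3) e by (intro forms_Cst_mult) simp
    ultimately show ?case by (intro bexI[of _ "Cst (-1) * (w1 * a)"]) auto
  qed
  have divide: "7 \<le> n \<longrightarrow> (\<exists>G\<in>forms (n - 1). \<forall>P\<in>Z. eval_poly p (rep P) = eval_poly l (rep P) * eval_poly G (rep P))"
    if "p \<in> hf (range Var) n" for n p
    using that
  proof (induction rule: hf_induct)
    case (zero d)
    show ?case by (intro impI bexI[of _ 0]) (auto simp: forms_eq_hf hf_zero)
  next
    case (add d p p')
    show ?case
    proof
      assume "7 \<le> d"
      then obtain G G' where "G \<in> forms (d - 1)" "G' \<in> forms (d - 1)"
        "\<forall>P\<in>Z. eval_poly p (rep P) = eval_poly l (rep P) * eval_poly G (rep P)"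
        "\<forall>P\<in>Z. eval_poly p' (rep P) = eval_poly l (rep P) * eval_poly G' (rep P)" using add by blast
      then show "\<exists>G\<in>forms (d - 1). \<forall>P\<in>Z. eval_poly (p + p') (rep P) = eval_poly l (rep P) * eval_poly G (rep P)"
        by (intro bexI[of _ "G + G'"] forms_add) (auto simp: distrib_left)
    qed
  next
    case (gen x d p)
    show ?case
    proof
      assume d7: "7 \<le> Suc d"
      show "\<exists>G\<in>forms (Suc d - 1). \<forall>P\<in>Z. eval_poly (x * p) (rep P) = eval_poly l (rep P) * eval_poly G (rep P)"
      proof (cases "7 \<le> d")
        case True
        then obtain G where G: "G \<in> forms (d - 1)"
          "\<forall>P\<in>Z. eval_poly p (rep P) = eval_poly l (rep P) * eval_poly G (rep P)" using gen by blast
        have "x * G \<in> forms (Suc (d - 1))" using gen(1) G(1) unfolding forms_eq_hf by (rule hf_gen)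
        then show ?thesis using G True by (intro bexI[of _ "x * G"]) auto
      next
        case False
        then have d: "d = 6" using d7 by simp
        \<comment> \<open>Only the passage from degree 6 to 7 uses the plane cubics; in higher
          degrees the quotient is just multiplied by \<open>x\<close>.\<close>
        have "x * p \<in> forms (Suc 6)" using gen(1,2) unfolding forms_eq_hf d by (rule hf_gen)
        then obtain p0 p1 where p: "p0 \<in> tern 7" "p1 \<in> forms 6" "x * p = p0 + l * p1"
          using split[of "x * p" 6] by auto
        obtain G where "G \<in> forms 6" "\<forall>P\<in>Z. eval_poly p0 (rep P) = eval_poly l (rep P) * eval_poly G (rep P)"
          using ideal_on_Z[OF gideal_degree_7[OF p(1)]] by auto
        then show ?thesis using p d by (intro bexI[of _ "G + p1"]) (auto simp: p(3) distrib_left intro: forms_add)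
      qed
    qed
  qed simp
  have divide_power: "\<exists>G\<in>forms 6. \<forall>P\<in>Z. eval_poly p (rep P) = eval_poly l (rep P) ^ k * eval_poly G (rep P)"
    if "p \<in> forms (6 + k)" for p k
    using that
  proof (induction k arbitrary: p)
    case 0
    then show ?case by auto
  next
    case (Suc k)
    then obtain G where G: "G \<in> forms (6 + k)" "\<forall>P\<in>Z. eval_poly p (rep P) = eval_poly l (rep P) * eval_poly G (rep P)"
      using divide[of p "6 + Suc k"] by (auto simp: forms_eq_hf)
    then show ?case using Suc.IH[OF G(1)] by (auto simp: mult.assoc)
  qed
  \<comment> \<open>The factor \<open>l ^ 6\<close> raises the degree of \<open>s\<close> to
    \<open>6 + card (Z - {Q})\<close>; division on \<open>Z\<close> by a power of \<open>l\<close>,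
    which has no zero there, then returns a sextic.\<close>
  obtain s where s: "s \<in> forms (card (Z - {Q}))" "\<forall>P\<in>Z - {Q}. eval_poly s (rep P) = 0" "eval_poly s (rep Q) \<noteq> 0"
    using separating_form[of "Z - {Q}" Q] finZ by auto
  have "l ^ 6 \<in> forms 6" using hf_power[of l "range Var" "Suc 0" 6] l(1) by (simp add: forms_eq_hf)
  then have "l ^ 6 * s \<in> forms (6 + card (Z - {Q}))" using s(1) by (rule forms_mult)
  then obtain G where G: "G \<in> forms 6"
    "\<And>P. P \<in> Z \<Longrightarrow> eval_poly (l ^ 6 * s) (rep P) = eval_poly l (rep P) ^ card (Z - {Q}) * eval_poly G (rep P)"
    using divide_power by blast
  have lZ: "eval_poly l (rep P) \<noteq> 0" if "P \<in> Z" for P using that Z l(3) by blast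
  have G0: "eval_poly G (rep P) = 0" if "P \<in> Z" "P \<noteq> Q" for P
    using G(2)[OF that(1)] s(2) that lZ[OF that(1)] by simp
  have GQ: "eval_poly G (rep Q) \<noteq> 0"
    using G(2)[OF Q] s(3) lZ[OF Q] by auto
  have "0 = (\<Sum>P\<in>Z. c P * eval_poly G (rep P))" using rel[OF G(1)] by simp
  also have "\<dots> = (\<Sum>P\<in>Z. if P = Q then c Q * eval_poly G (rep Q) else 0)"
    using G0 by (intro sum.cong) auto
  also have "\<dots> = c Q * eval_poly G (rep Q)" using finZ Q by simp
  finally show "c Q = 0" using GQ by simp
qed

section \<open>Uniqueness of the decomposition\<close>

text \<open>The space of cubics in four variables has dimension 20. Up to that number, each point in
  General Position imposes a new condition, so removing \<open>P\<close> admits a cubic that is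
  nonzero at \<open>P\<close>.\<close>

lemma general_position_separating_cubic:
  assumes "general_position A" "card A \<le> 20" "P \<in> A"
  shows "\<exists>q\<in>forms 3. eval_poly q (rep P) \<noteq> 0 \<and> (\<forall>Q\<in>A. Q \<noteq> P \<longrightarrow> eval_poly q (rep Q) = 0)"
proof -
  have fin: "finite A" using assms by (simp add: general_position_def)
  have choose: "(3 + 3) choose 3 = (20 :: nat)" by (simp add: eval_nat_numeral)
  have h: "hilbert_function A' 3 = min (card A') 20" if "A' \<subseteq> A" for A'
    using assms(1) that choose unfolding general_position_def by metis
  have "card (A - {P}) < card A" using fin assms(3) by (rule card_Diff1_less)
  then have "hilbert_function (A - {P}) 3 \<noteq> hilbert_function A 3"
    using h[of A] h[of "A - {P}"] assms(2) by simp
  then have "forms_through (A - {P}) 3 \<noteq> forms_through A 3"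
    by (auto simp: hilbert_function_def)
  moreover have "forms_through A 3 \<subseteq> forms_through (A - {P}) 3" by (auto simp: forms_through_def)
  ultimately obtain q where "q \<in> forms_through (A - {P}) 3" "q \<notin> forms_through A 3" by blast
  then show ?thesis by (intro bexI[of _ q]) (auto simp: forms_through_def vanishes_at_rep)
qed

text \<open>Shorter \<open>B\<close> are included, so that one statement yields both the rank and
  the uniqueness.\<close>

lemma decomposition_unique:
  assumes nonred: "nonredundant_decomposition 6 F A" and card: "card A \<le> 20"
    and gp: "general_position A" and base: "contains_no_curves (base_locus A 3)"
    and B: "decomposition 6 F B" "card B \<le> card A"
  shows "B = A"
proof (rule ccontr)
  assume "B \<noteq> A"
  have finA: "finite A" using gp by (simp add: general_position_def)
  have finB: "finite B" using B by (simp add: decomposition_def)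
  obtain a where a: "F = (\<Sum>P\<in>A. Cst (a P) * linear_form (rep P) ^ 6)" "\<forall>P\<in>A. a P \<noteq> 0"
    using nonredundant_coefficients[OF nonred] .
  obtain b where b: "F = (\<Sum>P\<in>B. Cst (b P) * linear_form (rep P) ^ 6)"
    using span_veronese[OF finB] B(1) by (auto simp: decomposition_def)
  \<comment> \<open>Coefficients at common points of \<open>A\<close> and \<open>B\<close> may
    cancel, so only the support \<open>Z\<close> of \<open>c\<close> is considered.\<close>
  define c where "c P = (if P \<in> A then a P else 0) - (if P \<in> B then b P else 0)" for P
  define Z where "Z = {P \<in> A \<union> B. c P \<noteq> 0}"
  have "F = (\<Sum>P\<in>A \<union> B. Cst (if P \<in> A then a P else 0) * linear_form (rep P) ^ 6)"
    unfolding a(1) by (rule sum.mono_neutral_cong_left) (use finA finB in auto)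
  moreover have "F = (\<Sum>P\<in>A \<union> B. Cst (if P \<in> B then b P else 0) * linear_form (rep P) ^ 6)"
    unfolding b by (rule sum.mono_neutral_cong_left) (use finA finB in auto)
  ultimately have "(\<Sum>P\<in>A \<union> B. Cst (c P) * linear_form (rep P) ^ 6) = F - F"
    unfolding c_def single_diff left_diff_distrib sum_subtractf by simp
  then have "(\<Sum>P\<in>A \<union> B. Cst (c P) * linear_form (rep P) ^ 6) = 0" by simp
  also have "(\<Sum>P\<in>A \<union> B. Cst (c P) * linear_form (rep P) ^ 6) = (\<Sum>P\<in>Z. Cst (c P) * linear_form (rep P) ^ 6)"
    by (rule sum.mono_neutral_right) (use finA finB in \<open>auto simp: Z_def\<close>)
  finally have relation: "(\<Sum>P\<in>Z. Cst (c P) * linear_form (rep P) ^ 6) = 0" .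
  have finZ: "finite Z" using finA finB by (simp add: Z_def)
  have rel: "(\<Sum>P\<in>Z. c P * eval_poly G (rep P)) = 0" if "G \<in> forms 6" for G
    using apolarity[OF finZ relation that] .
  \<comment> \<open>On \<open>A - B\<close> the coefficient is \<open>a P\<close>, so nothing
    cancels there. With \<open>card B \<le> card A\<close> this gives the inequality
    \<open>cards\<close> required by \<open>cubics_vanish_on_residual\<close>.\<close>
  have AB: "A - B \<subseteq> Z \<inter> A" "Z - A \<subseteq> B - A" using a(2) by (auto simp: Z_def c_def)
  have "card (Z - A) \<le> card (B - A)" using AB finB by (intro card_mono) auto
  also have "\<dots> \<le> card (A - B)" using card_le_sym_Diff finA finB B(2) by blast
  also have "\<dots> \<le> card (Z \<inter> A)" using AB finA by (intro card_mono) auto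
  finally have cards: "card (Z - A) \<le> card (Z \<inter> A)" .
  \<comment> \<open>By cardinality \<open>A \<subseteq> B\<close> would force equality; hence
    \<open>A - B\<close>, and with it \<open>Z\<close>, is nonempty.\<close>
  have "\<not> A \<subseteq> B" using card_seteq[OF finB] B(2) \<open>B \<noteq> A\<close> by metis
  then obtain Q where Q: "Q \<in> Z" using AB by blast
  have "\<forall>P\<in>A. \<exists>q\<in>forms 3. eval_poly q (rep P) \<noteq> 0 \<and> (\<forall>Q\<in>A. Q \<noteq> P \<longrightarrow> eval_poly q (rep Q) = 0)"
    using general_position_separating_cubic[OF gp card] by blast
  from bchoice[OF this[unfolded Bex_def]] obtain q where
    q: "\<forall>P\<in>A. q P \<in> forms 3 \<and> eval_poly (q P) (rep P) \<noteq> 0 \<and> (\<forall>Q\<in>A. Q \<noteq> P \<longrightarrow> eval_poly (q P) (rep Q) = 0)"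
    by blast
  let ?W = "forms_through A 3"
  have W: "w \<in> ?W \<longleftrightarrow> w \<in> forms 3 \<and> (\<forall>P\<in>A. eval_poly w (rep P) = 0)" for w
    by (auto simp: forms_through_def vanishes_at_rep)
  have "eval_poly w (rep P) = 0" if w: "w \<in> ?W" and P: "P \<in> Z" for w P
  proof (cases "P \<in> A")
    case False
    show ?thesis
    proof (rule cubics_vanish_on_residual[of "Z \<inter> A" "Z - A" c q])
      show "(\<Sum>P\<in>Z \<inter> A \<union> (Z - A). c P * eval_poly G (rep P)) = 0" if "G \<in> forms 6" for G
        using rel[OF that] by (simp add: Int_Diff_Un)
    qed (use finZ cards q w W P False in \<open>auto simp: Z_def\<close>)
  qed (use w W in auto)
  then have "Z \<subseteq> zero_locus ?W"
    using W by (auto simp: zero_locus_def vanishes_at_rep)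
  moreover have "finite (zero_locus ?W)"
  proof (rule ccontr)
    assume "infinite (zero_locus ?W)"
    moreover have "zariski_closed (zero_locus ?W)"
      unfolding zariski_closed_def using W by blast
    ultimately obtain C where "irreducible_curve C" "C \<subseteq> zero_locus ?W"
      by (metis infinite_closed_contains_curve)
    then show False using base by (auto simp: contains_no_curves_def base_locus_def)
  qed
  ultimately have "c Q = 0"
  proof (intro no_relation_on_finite_base_locus[of ?W Z c Q])
    show "?W \<subseteq> forms 3" using W by blast
    show "0 \<in> ?W" unfolding W by (simp add: forms_eq_hf hf_zero)
    show "p + q \<in> ?W" if "p \<in> ?W" "q \<in> ?W" for p q using that unfolding W by (simp add: forms_add)
    show "Cst a * p \<in> ?W" if "p \<in> ?W" for a p using that unfolding W by (simp add: forms_Cst_mult)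
  qed (use rel Q in auto)
  then show False using Q by (simp add: Z_def)
qed

theorem proposition3p2:
  fixes F :: poly4 and A :: "proj3 set"
  assumes "F \<in> forms 6"
    and "nonredundant_decomposition 6 F A"
    and "card A = 15"
    and "general_position A"
    and "contains_no_curves (base_locus A 3)"
  shows "waring_rank 6 F = 15 \<and> minimal_decomposition 6 F A \<and>
    (\<forall>B. minimal_decomposition 6 F B \<longrightarrow> B = A)"
proof -
  have unique: "B = A" if "decomposition 6 F B" "card B \<le> 15" for B
    using decomposition_unique[of F A B] assms that by simp
  have A: "decomposition 6 F A" using assms(2) by (simp add: nonredundant_decomposition_def)
  have rank: "waring_rank 6 F = 15"
    unfolding waring_rank_def
  proof (rule Least_equality)
    show "\<exists>A. decomposition 6 F A \<and> card A = 15" using A assms(3) by blast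
    show "15 \<le> r" if r: "\<exists>B. decomposition 6 F B \<and> card B = r" for r
    proof -
      obtain B where B: "decomposition 6 F B" "card B = r" using r by blast
      show ?thesis using unique[OF B(1)] B(2) assms(3) by (cases "r \<le> 15") auto
    qed
  qed
  show ?thesis
  proof (intro conjI allI impI)
    show "minimal_decomposition 6 F A" using A assms(3) rank by (simp add: minimal_decomposition_def)
    show "B = A" if "minimal_decomposition 6 F B" for B
      by (rule unique) (use that rank in \<open>simp_all add: minimal_decomposition_def\<close>)
  qed (fact rank)
qed

end
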